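(* Let $R$ be a ring (associative with unity, not necessarily commutative). Then: (1) each quasi-projective left $R$-module is quasi-flat; (2) each flat left $R$-module is quasi-flat.
   Context: All rings are associative with unity and all modules are unital. Let $R$ be a ring and $M$, $V$ left $R$-modules. $V$ is $M$-projective if the natural homomorphism $\mathrm{Hom}_R(V,M)\rightarrow\mathrm{Hom}_R(V,M/X)$ is surjective for every submodule $X$ of $M$. $V$ is quasi-projective if $V$ is $V$-projective. $V$ is $M$-\underline{flat} (the underlining distinguishes this notion from ordinary flatness) if for any left $R$-module $M'$, any epimorphism $p:M\rightarrow M'$, any homomorphism $u:V\rightarrow M'$, any finitely presented left $R$-module $G$ and any homomorphism $v:G\rightarrow V$, there exists a homomorphism $q:G\rightarrow M$ such that $pq=uv$. $V$ is quasi-flat if $V$ is $V^n$-\underline{flat} for each integer $n>0$. *)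

theory Defs
  imports
    "HOL-Algebra.Free_Abelian_Groups"
    "HOL-Algebra.AbelCoset"
    "HOL-Algebra.Module"
begin

section \<open>Modules over a not necessarily commutative ring\<close>

text \<open>
  The locale \<^locale>\<open>module\<close> of HOL-Algebra requires a commutative ring of scalars, so left and
  right modules are introduced here, on the library's record type of modules. The fields
  \<open>mult\<close> and \<open>one\<close> of that record carry no meaning for modules.
\<close>

locale left_module = R?: ring R + M?: abelian_group M for R (structure) and M (structure) +
  assumes smult_closed [simp, intro]:
      "\<lbrakk>a \<in> carrier R; x \<in> carrier M\<rbrakk> \<Longrightarrow> a \<odot>\<^bsub>M\<^esub> x \<in> carrier M"
    and smult_l_distr:
      "\<lbrakk>a \<in> carrier R; b \<in> carrier R; x \<in> carrier M\<rbrakk> \<Longrightarrow>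
        (a \<oplus> b) \<odot>\<^bsub>M\<^esub> x = a \<odot>\<^bsub>M\<^esub> x \<oplus>\<^bsub>M\<^esub> b \<odot>\<^bsub>M\<^esub> x"
    and smult_r_distr:
      "\<lbrakk>a \<in> carrier R; x \<in> carrier M; y \<in> carrier M\<rbrakk> \<Longrightarrow>
        a \<odot>\<^bsub>M\<^esub> (x \<oplus>\<^bsub>M\<^esub> y) = a \<odot>\<^bsub>M\<^esub> x \<oplus>\<^bsub>M\<^esub> a \<odot>\<^bsub>M\<^esub> y"
    and smult_assoc:
      "\<lbrakk>a \<in> carrier R; b \<in> carrier R; x \<in> carrier M\<rbrakk> \<Longrightarrow>
        (a \<otimes> b) \<odot>\<^bsub>M\<^esub> x = a \<odot>\<^bsub>M\<^esub> (b \<odot>\<^bsub>M\<^esub> x)"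
    and smult_one [simp]:
      "x \<in> carrier M \<Longrightarrow> \<one> \<odot>\<^bsub>M\<^esub> x = x"

text \<open>In a right module, \<open>a \<odot> x\<close> is to be read as the product \<open>x a\<close>.\<close>

locale right_module = R?: ring R + M?: abelian_group M for R (structure) and M (structure) +
  assumes smult_closed [simp, intro]:
      "\<lbrakk>a \<in> carrier R; x \<in> carrier M\<rbrakk> \<Longrightarrow> a \<odot>\<^bsub>M\<^esub> x \<in> carrier M"
    and smult_l_distr:
      "\<lbrakk>a \<in> carrier R; b \<in> carrier R; x \<in> carrier M\<rbrakk> \<Longrightarrow>
        (a \<oplus> b) \<odot>\<^bsub>M\<^esub> x = a \<odot>\<^bsub>M\<^esub> x \<oplus>\<^bsub>M\<^esub> b \<odot>\<^bsub>M\<^esub> x"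
    and smult_r_distr:
      "\<lbrakk>a \<in> carrier R; x \<in> carrier M; y \<in> carrier M\<rbrakk> \<Longrightarrow>
        a \<odot>\<^bsub>M\<^esub> (x \<oplus>\<^bsub>M\<^esub> y) = a \<odot>\<^bsub>M\<^esub> x \<oplus>\<^bsub>M\<^esub> a \<odot>\<^bsub>M\<^esub> y"
    and smult_assoc:
      "\<lbrakk>a \<in> carrier R; b \<in> carrier R; x \<in> carrier M\<rbrakk> \<Longrightarrow>
        (a \<otimes> b) \<odot>\<^bsub>M\<^esub> x = b \<odot>\<^bsub>M\<^esub> (a \<odot>\<^bsub>M\<^esub> x)"
    and smult_one [simp]:
      "x \<in> carrier M \<Longrightarrow> \<one> \<odot>\<^bsub>M\<^esub> x = x"

text \<open>
  Homomorphisms are functions considered on the carrier only; the definition serves left and right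
  modules alike.
\<close>

definition mod_hom ::
    "('r, 'k) ring_scheme \<Rightarrow> ('r, 'a, 'l) module_scheme \<Rightarrow> ('r, 'b, 'm) module_scheme \<Rightarrow> ('a \<Rightarrow> 'b) set"
  where "mod_hom R M N =
    {h. h \<in> carrier M \<rightarrow> carrier N \<and>
        (\<forall>x\<in>carrier M. \<forall>y\<in>carrier M. h (x \<oplus>\<^bsub>M\<^esub> y) = h x \<oplus>\<^bsub>N\<^esub> h y) \<and>
        (\<forall>a\<in>carrier R. \<forall>x\<in>carrier M. h (a \<odot>\<^bsub>M\<^esub> x) = a \<odot>\<^bsub>N\<^esub> h x)}"

definition mod_epi ::
    "('r, 'k) ring_scheme \<Rightarrow> ('r, 'a, 'l) module_scheme \<Rightarrow> ('r, 'b, 'm) module_scheme \<Rightarrow> ('a \<Rightarrow> 'b) set"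
  where "mod_epi R M N = {h \<in> mod_hom R M N. h ` carrier M = carrier N}"

text \<open>
  In \<open>M/X\<close> the class of \<open>c\<close> is the coset \<open>X +> c\<close>; multiplying a coset by \<open>a\<close> merges the classes of
  \<open>a c\<close> for all its representatives \<open>c\<close>, which coincide if \<open>X\<close> is a submodule.
\<close>

definition quotient_module ::
    "('r, 'a, 'l) module_scheme \<Rightarrow> 'a set \<Rightarrow> ('r, 'a set) module"
  where "quotient_module M X =
    \<lparr>carrier = a_rcosets\<^bsub>M\<^esub> X, mult = undefined, one = undefined, zero = X, add = set_add M,
     smult = (\<lambda>a C. \<Union>c\<in>C. X +>\<^bsub>M\<^esub> (a \<odot>\<^bsub>M\<^esub> c))\<rparr>"

definition module_power ::
    "('r, 'a, 'l) module_scheme \<Rightarrow> nat \<Rightarrow> ('r, nat \<Rightarrow> 'a) module"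
  where "module_power M n =
    \<lparr>carrier = {..<n} \<rightarrow>\<^sub>E carrier M, mult = undefined, one = undefined,
     zero = (\<lambda>i\<in>{..<n}. \<zero>\<^bsub>M\<^esub>),
     add = (\<lambda>x y. \<lambda>i\<in>{..<n}. x i \<oplus>\<^bsub>M\<^esub> y i),
     smult = (\<lambda>a x. \<lambda>i\<in>{..<n}. a \<odot>\<^bsub>M\<^esub> x i)\<rparr>"

definition regular_left_module :: "('r, 'k) ring_scheme \<Rightarrow> ('r, 'r) module"
  where "regular_left_module R =
    \<lparr>carrier = carrier R, mult = mult R, one = one R, zero = zero R, add = add R, smult = mult R\<rparr>"

abbreviation free_left_module :: "('r, 'k) ring_scheme \<Rightarrow> nat \<Rightarrow> ('r, nat \<Rightarrow> 'r) module"
  where "free_left_module R n \<equiv> module_power (regular_left_module R) n"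

text \<open>There is an exact sequence \<open>R\<^sup>m \<rightarrow> R\<^sup>n \<rightarrow> G \<rightarrow> 0\<close>.\<close>

definition finitely_presented ::
    "('r, 'k) ring_scheme \<Rightarrow> ('r, 'g, 'l) module_scheme \<Rightarrow> bool"
  where "finitely_presented R G \<longleftrightarrow>
    (\<exists>m n. \<exists>f\<in>mod_hom R (free_left_module R m) (free_left_module R n).
       \<exists>h\<in>mod_epi R (free_left_module R n) G.
         f ` carrier (free_left_module R m) = a_kernel (free_left_module R n) G h)"


section \<open>Quasi-projective and quasi-flat modules\<close>

definition rel_projective ::
    "('r, 'k) ring_scheme \<Rightarrow> ('r, 'm, 'l) module_scheme \<Rightarrow> ('r, 'v, 'n) module_scheme \<Rightarrow> bool"
  where "rel_projective R M V \<longleftrightarrow>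
    (\<forall>X. submodule X R M \<longrightarrow>
      (\<forall>g\<in>mod_hom R V (quotient_module M X).
         \<exists>h\<in>mod_hom R V M. \<forall>v\<in>carrier V. X +>\<^bsub>M\<^esub> h v = g v))"

definition quasi_projective ::
    "('r, 'k) ring_scheme \<Rightarrow> ('r, 'v, 'n) module_scheme \<Rightarrow> bool"
  where "quasi_projective R V \<longleftrightarrow> rel_projective R V V"

text \<open>
  \<open>V\<close> is \<open>M\<close>-\<open>flat\<close> (the underlined notion). HOL has no quantification over types inside a
  formula: the types \<open>'x\<close> of the elements of \<open>M'\<close> and \<open>'g\<close> of the elements of \<open>G\<close> are parameters,
  and a theorem that concludes relative flatness for arbitrary \<open>'x\<close> and \<open>'g\<close> covers all \<open>M'\<close>
  and all \<open>G\<close>.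
\<close>

definition rel_flat ::
    "'x itself \<Rightarrow> 'g itself \<Rightarrow> ('r, 'k) ring_scheme \<Rightarrow>
     ('r, 'm, 'l) module_scheme \<Rightarrow> ('r, 'v, 'n) module_scheme \<Rightarrow> bool"
  where "rel_flat TX TG R M V \<longleftrightarrow>
    (\<forall>(M' :: ('r, 'x) module) p u (G :: ('r, 'g) module) v.
       left_module R M' \<and> p \<in> mod_epi R M M' \<and> u \<in> mod_hom R V M' \<and>
       left_module R G \<and> finitely_presented R G \<and> v \<in> mod_hom R G V \<longrightarrow>
       (\<exists>q\<in>mod_hom R G M. \<forall>g\<in>carrier G. p (q g) = u (v g)))"

definition quasi_flat ::
    "'x itself \<Rightarrow> 'g itself \<Rightarrow> ('r, 'k) ring_scheme \<Rightarrow> ('r, 'v, 'n) module_scheme \<Rightarrow> bool"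
  where "quasi_flat TX TG R V \<longleftrightarrow> (\<forall>n>0. rel_flat TX TG R (module_power V n) V)"


section \<open>Tensor products and flat modules\<close>

text \<open>
  The tensor product of a right module \<open>A\<close> and a left module \<open>V\<close> is the free abelian group on
  \<open>A \<times> V\<close> modulo the subgroup generated by the expressions that biadditivity and
  \<open>(x a) \<otimes> v = x \<otimes> (a v)\<close> require to vanish.
\<close>

definition tensor_rels ::
    "('r, 'k) ring_scheme \<Rightarrow> ('r, 'a, 'l) module_scheme \<Rightarrow> ('r, 'v, 'n) module_scheme \<Rightarrow>
     ('a \<times> 'v \<Rightarrow>\<^sub>0 int) set"
  where "tensor_rels R A V = generate (free_Abelian_group (carrier A \<times> carrier V))
    ({frag_of (x \<oplus>\<^bsub>A\<^esub> y, v) - frag_of (x, v) - frag_of (y, v) | x y v.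
        x \<in> carrier A \<and> y \<in> carrier A \<and> v \<in> carrier V} \<union>
     {frag_of (x, v \<oplus>\<^bsub>V\<^esub> w) - frag_of (x, v) - frag_of (x, w) | x v w.
        x \<in> carrier A \<and> v \<in> carrier V \<and> w \<in> carrier V} \<union>
     {frag_of (a \<odot>\<^bsub>A\<^esub> x, v) - frag_of (x, a \<odot>\<^bsub>V\<^esub> v) | x a v.
        x \<in> carrier A \<and> a \<in> carrier R \<and> v \<in> carrier V})"

definition tensor_product ::
    "('r, 'k) ring_scheme \<Rightarrow> ('r, 'a, 'l) module_scheme \<Rightarrow> ('r, 'v, 'n) module_scheme \<Rightarrow>
     ('a \<times> 'v \<Rightarrow>\<^sub>0 int) set monoid"
  where "tensor_product R A V =
    free_Abelian_group (carrier A \<times> carrier V) Mod tensor_rels R A V"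

text \<open>
  The map \<open>f \<otimes> id\<close> from \<open>A \<otimes> V\<close> to \<open>B \<otimes> V\<close>; as for quotient modules, the union is over one and the
  same coset for all representatives \<open>c\<close> of \<open>C\<close>.
\<close>

definition tensor_map ::
    "('r, 'k) ring_scheme \<Rightarrow> ('r, 'b, 'l) module_scheme \<Rightarrow> ('r, 'v, 'n) module_scheme \<Rightarrow>
     ('a \<Rightarrow> 'b) \<Rightarrow> ('a \<times> 'v \<Rightarrow>\<^sub>0 int) set \<Rightarrow> ('b \<times> 'v \<Rightarrow>\<^sub>0 int) set"
  where "tensor_map R B V f C =
    (\<Union>c\<in>C. tensor_rels R B V #>\<^bsub>free_Abelian_group (carrier B \<times> carrier V)\<^esub>
       frag_extend (\<lambda>(x, v). frag_of (f x, v)) c)"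

text \<open>
  \<open>V\<close> is flat if tensoring with \<open>V\<close> preserves injectivity of homomorphisms of right modules. The
  type \<open>'a\<close> of the elements of the right modules tested is a parameter again. For every \<open>'a\<close> this
  is a consequence of flatness, so that as a hypothesis it is weaker the fewer modules
  live on \<open>'a\<close>. On \<open>(nat \<Rightarrow> 'r) set\<close> all countably generated right modules over a ring with elements
  in \<open>'r\<close> occur up to isomorphism, as quotients of the right module of finitely supported
  sequences.
\<close>

definition flat ::
    "'a itself \<Rightarrow> ('r, 'k) ring_scheme \<Rightarrow> ('r, 'v, 'n) module_scheme \<Rightarrow> bool"
  where "flat TA R V \<longleftrightarrow>
    (\<forall>(A :: ('r, 'a) module) (B :: ('r, 'a) module) f.
       right_module R A \<and> right_module R B \<and> f \<in> mod_hom R A B \<and> inj_on f (carrier A) \<longrightarrow>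
       inj_on (tensor_map R B V f) (carrier (tensor_product R A V)))"

end

theory Submission
  imports Defs
begin

text \<open>
  Both claims produce a lift of \<open>u \<circ> v : G \<rightarrow> V \<rightarrow> M'\<close> along an epimorphism \<open>p : M \<rightarrow> M'\<close>, but at
  different places.

  A quasi-projective \<open>V\<close> lifts \<open>u\<close> itself, along any epimorphism from a power \<open>V\<^sup>n\<close>
  (\<open>rel_projective_lift_power\<close>). The homomorphism \<open>p\<close> is a sum of \<open>n\<close> homomorphisms
  \<open>p\<^sub>i : V \<rightarrow> M'\<close>. Modulo the submodule \<open>N\<close> spanned by the images of all but the last of them, \<open>u\<close> takes
  values in the image of \<open>p\<^sub>n\<close>; projectivity relative to the single module \<open>V\<close> gives \<open>k\<close> such that
  \<open>u - p\<^sub>n k\<close> takes values in \<open>N\<close>, and induction lifts this difference.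

  For a flat \<open>V\<close> the homomorphism \<open>v\<close> factors as \<open>G \<rightarrow> R\<^sup>k \<rightarrow> V\<close>
  (\<open>flat_hom_from_finitely_presented_factors\<close>), and \<open>R\<^sup>k \<rightarrow> V \<rightarrow> M'\<close> lifts to any module \<open>M\<close> that maps
  onto \<open>M'\<close>, because \<open>R\<^sup>k\<close> is free. The factorization is the equational criterion for flatness. If
  \<open>R\<^sup>m \<rightarrow> R\<^sup>n \<rightarrow> G \<rightarrow> 0\<close> is a presentation with matrix \<open>(a\<^sub>i\<^sub>j)\<close>, then \<open>v\<close> is given by elements
  \<open>v\<^sub>j\<close> of \<open>V\<close> with \<open>\<Sum>\<^sub>j a\<^sub>i\<^sub>j v\<^sub>j = 0\<close> for all \<open>i\<close>, and one needs elements \<open>w\<^sub>l\<close> of \<open>V\<close> and scalars \<open>b\<^sub>l\<^sub>j\<close> with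
  \<open>v\<^sub>j = \<Sum>\<^sub>l b\<^sub>l\<^sub>j w\<^sub>l\<close> and \<open>\<Sum>\<^sub>j a\<^sub>i\<^sub>j b\<^sub>l\<^sub>j = 0\<close>. Let \<open>y\<^sub>j\<close> be the columns of the matrix, in the right module
  \<open>R\<^sup>m\<close>. The relations say that \<open>\<Sum>\<^sub>j y\<^sub>j \<otimes> v\<^sub>j = 0\<close> in \<open>R\<^sup>m \<otimes> V\<close>. Flatness, applied to the inclusion
  of the span of the columns, turns this into an equation over that span, and there a vanishing
  tensor is accounted for by relations between the columns
  (\<open>flat_tensor_zero_imp_relations\<close>); these relations are the \<open>b\<^sub>l\<close>.
\<close>

section \<open>Homomorphisms of left modules\<close>

lemma (in abelian_group) minus_eq_zero_iff:
  "\<lbrakk>x \<in> carrier G; y \<in> carrier G\<rbrakk> \<Longrightarrow> x \<ominus> y = \<zero> \<longleftrightarrow> x = y"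
  using add.inv_solve_right[of \<zero> x y] by (auto simp: a_minus_def)

lemma (in abelian_group) minus_add_cancel:
  "\<lbrakk>x \<in> carrier G; y \<in> carrier G\<rbrakk> \<Longrightarrow> (x \<ominus> y) \<oplus> y = x"
  by (simp add: a_minus_def a_assoc l_neg)

lemma (in abelian_group) add_minus_cancel:
  "\<lbrakk>x \<in> carrier G; y \<in> carrier G\<rbrakk> \<Longrightarrow> (x \<oplus> y) \<ominus> y = x"
  by (simp add: a_minus_def a_assoc r_neg)

lemma (in abelian_group) minus_telescope:
  "\<lbrakk>x \<in> carrier G; y \<in> carrier G; z \<in> carrier G\<rbrakk> \<Longrightarrow> (x \<ominus> y) \<oplus> (y \<ominus> z) = x \<ominus> z"
  by (simp add: a_minus_def a_assoc r_neg1)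

lemma (in abelian_group) uminus_minus_swap:
  "\<lbrakk>x \<in> carrier G; y \<in> carrier G\<rbrakk> \<Longrightarrow> \<ominus> (x \<ominus> y) = y \<ominus> x"
  by (simp add: a_minus_def minus_add a_comm)

context left_module
begin

lemma smult_zero_left [simp]: "x \<in> carrier M \<Longrightarrow> \<zero>\<^bsub>R\<^esub> \<odot>\<^bsub>M\<^esub> x = \<zero>\<^bsub>M\<^esub>"
  using smult_l_distr[of "\<zero>\<^bsub>R\<^esub>" "\<zero>\<^bsub>R\<^esub>" x] by (metis M.add.r_cancel_one' R.l_zero R.zero_closed smult_closed)

lemma smult_zero_right [simp]: "a \<in> carrier R \<Longrightarrow> a \<odot>\<^bsub>M\<^esub> \<zero>\<^bsub>M\<^esub> = \<zero>\<^bsub>M\<^esub>"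
  using smult_r_distr[of a "\<zero>\<^bsub>M\<^esub>" "\<zero>\<^bsub>M\<^esub>"] by (metis M.add.r_cancel_one' M.l_zero M.zero_closed smult_closed)

lemma smult_minus_right:
  assumes "a \<in> carrier R" "x \<in> carrier M"
  shows "a \<odot>\<^bsub>M\<^esub> (\<ominus>\<^bsub>M\<^esub> x) = \<ominus>\<^bsub>M\<^esub> (a \<odot>\<^bsub>M\<^esub> x)"
proof -
  have "a \<odot>\<^bsub>M\<^esub> (\<ominus>\<^bsub>M\<^esub> x) \<oplus>\<^bsub>M\<^esub> a \<odot>\<^bsub>M\<^esub> x = \<zero>\<^bsub>M\<^esub>"
    using assms smult_r_distr[of a "\<ominus>\<^bsub>M\<^esub> x" x] by (simp add: M.l_neg)
  then show ?thesis using assms by (simp add: M.minus_equality)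
qed

end

lemma mod_homI:
  assumes "\<And>x. x \<in> carrier M \<Longrightarrow> h x \<in> carrier N"
    and "\<And>x y. \<lbrakk>x \<in> carrier M; y \<in> carrier M\<rbrakk> \<Longrightarrow> h (x \<oplus>\<^bsub>M\<^esub> y) = h x \<oplus>\<^bsub>N\<^esub> h y"
    and "\<And>a x. \<lbrakk>a \<in> carrier R; x \<in> carrier M\<rbrakk> \<Longrightarrow> h (a \<odot>\<^bsub>M\<^esub> x) = a \<odot>\<^bsub>N\<^esub> h x"
  shows "h \<in> mod_hom R M N"
  using assms by (auto simp: mod_hom_def)

lemma mod_hom_closed: "\<lbrakk>h \<in> mod_hom R M N; x \<in> carrier M\<rbrakk> \<Longrightarrow> h x \<in> carrier N"
  and mod_hom_add:
    "\<lbrakk>h \<in> mod_hom R M N; x \<in> carrier M; y \<in> carrier M\<rbrakk> \<Longrightarrow> h (x \<oplus>\<^bsub>M\<^esub> y) = h x \<oplus>\<^bsub>N\<^esub> h y"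
  and mod_hom_smult:
    "\<lbrakk>h \<in> mod_hom R M N; a \<in> carrier R; x \<in> carrier M\<rbrakk> \<Longrightarrow> h (a \<odot>\<^bsub>M\<^esub> x) = a \<odot>\<^bsub>N\<^esub> h x"
  by (auto simp: mod_hom_def)

lemma mod_hom_comp:
  "\<lbrakk>h \<in> mod_hom R M N; k \<in> mod_hom R N P\<rbrakk> \<Longrightarrow> (\<lambda>x. k (h x)) \<in> mod_hom R M P"
  by (intro mod_homI) (simp_all add: mod_hom_closed mod_hom_add mod_hom_smult)

lemma mod_epi_hom: "h \<in> mod_epi R M N \<Longrightarrow> h \<in> mod_hom R M N"
  by (simp add: mod_epi_def)

lemma mod_epi_surj: "\<lbrakk>h \<in> mod_epi R M N; y \<in> carrier N\<rbrakk> \<Longrightarrow> \<exists>x\<in>carrier M. h x = y"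
  by (force simp: mod_epi_def)

lemma mod_hom_zero:
  assumes "abelian_group M" "abelian_group N" "h \<in> mod_hom R M N"
  shows "h \<zero>\<^bsub>M\<^esub> = \<zero>\<^bsub>N\<^esub>"
proof -
  interpret M: abelian_group M by fact
  interpret N: abelian_group N by fact
  have "h \<zero>\<^bsub>M\<^esub> \<oplus>\<^bsub>N\<^esub> h \<zero>\<^bsub>M\<^esub> = h \<zero>\<^bsub>M\<^esub>"
    using mod_hom_add[OF assms(3), of "\<zero>\<^bsub>M\<^esub>" "\<zero>\<^bsub>M\<^esub>"] by simp
  then show ?thesis
    using mod_hom_closed[OF assms(3)] by simp
qed

lemma mod_hom_uminus:
  assumes "abelian_group M" "abelian_group N" "h \<in> mod_hom R M N" "x \<in> carrier M"
  shows "h (\<ominus>\<^bsub>M\<^esub> x) = \<ominus>\<^bsub>N\<^esub> h x"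
proof -
  interpret M: abelian_group M by fact
  interpret N: abelian_group N by fact
  have "h (\<ominus>\<^bsub>M\<^esub> x) \<oplus>\<^bsub>N\<^esub> h x = \<zero>\<^bsub>N\<^esub>"
    using mod_hom_add[OF assms(3), of "\<ominus>\<^bsub>M\<^esub> x" x] mod_hom_zero[OF assms(1-3)] assms(4)
    by (simp add: M.l_neg)
  then show ?thesis
    using mod_hom_closed[OF assms(3)] assms(4) by (simp add: N.minus_equality)
qed

lemma mod_hom_minus:
  assumes "abelian_group M" "abelian_group N" "h \<in> mod_hom R M N" "x \<in> carrier M" "y \<in> carrier M"
  shows "h (x \<ominus>\<^bsub>M\<^esub> y) = h x \<ominus>\<^bsub>N\<^esub> h y"
proof -
  interpret M: abelian_group M by fact
  show ?thesis
    using assms by (simp add: a_minus_def mod_hom_add mod_hom_uminus)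
qed

lemma mod_hom_finsum:
  assumes M: "abelian_group M" and N: "abelian_group N" and h: "h \<in> mod_hom R M N"
    and f: "f \<in> S \<rightarrow> carrier M"
  shows "h (finsum M f S) = finsum N (\<lambda>s. h (f s)) S"
proof -
  interpret M: abelian_group M by fact
  interpret N: abelian_group N by fact
  show ?thesis
    using f
  proof (induction S rule: infinite_finite_induct)
    case (infinite S)
    then show ?case by (simp add: M.finsum_infinite N.finsum_infinite mod_hom_zero[OF M N h])
  next
    case empty
    then show ?case by (simp add: mod_hom_zero[OF M N h])
  next
    case (insert s S)
    then have "h (finsum M f (insert s S)) = h (f s) \<oplus>\<^bsub>N\<^esub> h (finsum M f S)"
      by (simp add: Pi_iff mod_hom_add[OF h])
    also have "\<dots> = finsum N (\<lambda>s. h (f s)) (insert s S)"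
      using insert by (simp add: Pi_iff mod_hom_closed[OF h])
    finally show ?case .
  qed
qed

lemma mod_hom_eqI:
  assumes "abelian_group M" "abelian_group N" "h \<in> mod_hom R M N" "x \<in> carrier M" "y \<in> carrier M"
    and "h (x \<ominus>\<^bsub>M\<^esub> y) = \<zero>\<^bsub>N\<^esub>"
  shows "h x = h y"
proof -
  interpret N: abelian_group N by fact
  show ?thesis
    using mod_hom_minus[OF assms(1-5)] assms(6) mod_hom_closed[OF assms(3)] assms(4,5)
    by (metis N.minus_eq_zero_iff)
qed

text \<open>
  The first isomorphism theorem in the form in which homomorphisms out of a presented module arise.
\<close>

lemma mod_hom_factor_epi:
  assumes F: "left_module R F" and G: "left_module R G" and N: "abelian_group N"
    and h: "h \<in> mod_epi R F G" and k: "k \<in> mod_hom R F N"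
    and ker: "\<And>x. \<lbrakk>x \<in> carrier F; h x = \<zero>\<^bsub>G\<^esub>\<rbrakk> \<Longrightarrow> k x = \<zero>\<^bsub>N\<^esub>"
  shows "\<exists>q\<in>mod_hom R G N. \<forall>x\<in>carrier F. q (h x) = k x"
proof -
  interpret F: left_module R F by fact
  interpret G: left_module R G by fact
  note hh = mod_epi_hom[OF h]
  define s where "s g = (SOME x. x \<in> carrier F \<and> h x = g)" for g
  have s: "s g \<in> carrier F \<and> h (s g) = g" if "g \<in> carrier G" for g
    unfolding s_def by (rule someI_ex) (use mod_epi_surj[OF h that] in blast)
  have key: "k x = k y" if "x \<in> carrier F" "y \<in> carrier F" "h x = h y" for x y
  proof (rule mod_hom_eqI[OF F.M.abelian_group_axioms N k that(1,2)], rule ker)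
    show "h (x \<ominus>\<^bsub>F\<^esub> y) = \<zero>\<^bsub>G\<^esub>"
      using that mod_hom_closed[OF hh] mod_hom_minus[OF F.M.abelian_group_axioms G.M.abelian_group_axioms hh]
      by (metis G.M.minus_eq_zero_iff)
  qed (use that in simp)
  show ?thesis
  proof (intro bexI[of _ "\<lambda>g. k (s g)"] ballI mod_homI)
    fix x assume x: "x \<in> carrier F"
    show "k (s (h x)) = k x"
      using s[of "h x"] mod_hom_closed[OF hh x] x by (intro key) auto
  next
    fix x y assume "x \<in> carrier G" "y \<in> carrier G"
    then show "k (s (x \<oplus>\<^bsub>G\<^esub> y)) = k (s x) \<oplus>\<^bsub>N\<^esub> k (s y)"
      using s by (simp add: mod_hom_add[OF k, symmetric] mod_hom_add[OF hh] key)
  next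
    fix a x assume "a \<in> carrier R" "x \<in> carrier G"
    then show "k (s (a \<odot>\<^bsub>G\<^esub> x)) = a \<odot>\<^bsub>N\<^esub> k (s x)"
      using s by (simp add: mod_hom_smult[OF k, symmetric] mod_hom_smult[OF hh] key)
  qed (use s mod_hom_closed[OF k] in auto)
qed

section \<open>Powers and free modules\<close>

lemma module_power_simps [simp]:
  "carrier (module_power M n) = {..<n} \<rightarrow>\<^sub>E carrier M"
  "\<zero>\<^bsub>module_power M n\<^esub> = (\<lambda>i\<in>{..<n}. \<zero>\<^bsub>M\<^esub>)"
  "x \<oplus>\<^bsub>module_power M n\<^esub> y = (\<lambda>i\<in>{..<n}. x i \<oplus>\<^bsub>M\<^esub> y i)"
  "a \<odot>\<^bsub>module_power M n\<^esub> x = (\<lambda>i\<in>{..<n}. a \<odot>\<^bsub>M\<^esub> x i)"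
  by (simp_all add: module_power_def)

lemma PiE_lessThan_mem: "\<lbrakk>x \<in> {..<n} \<rightarrow>\<^sub>E C; i < n\<rbrakk> \<Longrightarrow> x i \<in> C"
  by auto

lemma left_module_power:
  assumes "left_module R M"
  shows "left_module R (module_power M n)"
proof -
  interpret left_module R M by fact
  have restrict_id: "(\<lambda>i\<in>{..<n}. f i) = x"
    if "x \<in> {..<n} \<rightarrow>\<^sub>E carrier M" "\<And>i. i < n \<Longrightarrow> f i = x i" for f x
    using that by (intro extensionalityI[of _ "{..<n}"]) (auto simp: PiE_iff)
  have "abelian_group (module_power M n)"
  proof (rule abelian_groupI, unfold module_power_simps)
    fix x assume x: "x \<in> {..<n} \<rightarrow>\<^sub>E carrier M"
    show "\<exists>y\<in>{..<n} \<rightarrow>\<^sub>E carrier M. (\<lambda>i\<in>{..<n}. y i \<oplus>\<^bsub>M\<^esub> x i) = (\<lambda>i\<in>{..<n}. \<zero>\<^bsub>M\<^esub>)"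
    proof (rule bexI[of _ "\<lambda>i\<in>{..<n}. \<ominus>\<^bsub>M\<^esub> x i"])
      show "(\<lambda>i\<in>{..<n}. (\<lambda>i\<in>{..<n}. \<ominus>\<^bsub>M\<^esub> x i) i \<oplus>\<^bsub>M\<^esub> x i) = (\<lambda>i\<in>{..<n}. \<zero>\<^bsub>M\<^esub>)"
        using x by (intro restrict_ext) (simp add: M.l_neg PiE_lessThan_mem)
    qed (use x in \<open>simp add: PiE_lessThan_mem\<close>)
    show "(\<lambda>i\<in>{..<n}. (\<lambda>i\<in>{..<n}. \<zero>\<^bsub>M\<^esub>) i \<oplus>\<^bsub>M\<^esub> x i) = x"
      using x by (intro restrict_id) (simp_all add: PiE_lessThan_mem)
  next
    fix x y z
    assume x: "x \<in> {..<n} \<rightarrow>\<^sub>E carrier M" and y: "y \<in> {..<n} \<rightarrow>\<^sub>E carrier M"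
    show "(\<lambda>i\<in>{..<n}. x i \<oplus>\<^bsub>M\<^esub> y i) \<in> {..<n} \<rightarrow>\<^sub>E carrier M"
      using x y by (simp add: PiE_lessThan_mem)
    show "(\<lambda>i\<in>{..<n}. x i \<oplus>\<^bsub>M\<^esub> y i) = (\<lambda>i\<in>{..<n}. y i \<oplus>\<^bsub>M\<^esub> x i)"
      using x y by (intro restrict_ext M.a_comm) (simp_all add: PiE_lessThan_mem)
    assume z: "z \<in> {..<n} \<rightarrow>\<^sub>E carrier M"
    show "(\<lambda>i\<in>{..<n}. (\<lambda>i\<in>{..<n}. x i \<oplus>\<^bsub>M\<^esub> y i) i \<oplus>\<^bsub>M\<^esub> z i)
        = (\<lambda>i\<in>{..<n}. x i \<oplus>\<^bsub>M\<^esub> (\<lambda>i\<in>{..<n}. y i \<oplus>\<^bsub>M\<^esub> z i) i)"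
      using x y z by (intro restrict_ext) (simp add: PiE_lessThan_mem M.a_assoc)
  qed simp
  moreover have "left_module_axioms R (module_power M n)"
  proof (unfold_locales, unfold module_power_simps)
    fix a b x y
    assume a: "a \<in> carrier R" and x: "x \<in> {..<n} \<rightarrow>\<^sub>E carrier M"
    show "(\<lambda>i\<in>{..<n}. a \<odot>\<^bsub>M\<^esub> x i) \<in> {..<n} \<rightarrow>\<^sub>E carrier M"
      using a x by (simp add: PiE_lessThan_mem)
    show "(\<lambda>i\<in>{..<n}. a \<odot>\<^bsub>M\<^esub> (\<lambda>i\<in>{..<n}. x i \<oplus>\<^bsub>M\<^esub> y i) i)
        = (\<lambda>i\<in>{..<n}. (\<lambda>i\<in>{..<n}. a \<odot>\<^bsub>M\<^esub> x i) i \<oplus>\<^bsub>M\<^esub> (\<lambda>i\<in>{..<n}. a \<odot>\<^bsub>M\<^esub> y i) i)"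
      if "y \<in> {..<n} \<rightarrow>\<^sub>E carrier M"
      using a x that by (intro restrict_ext) (simp add: PiE_lessThan_mem smult_r_distr)
    assume b: "b \<in> carrier R"
    show "(\<lambda>i\<in>{..<n}. (a \<oplus>\<^bsub>R\<^esub> b) \<odot>\<^bsub>M\<^esub> x i)
        = (\<lambda>i\<in>{..<n}. (\<lambda>i\<in>{..<n}. a \<odot>\<^bsub>M\<^esub> x i) i \<oplus>\<^bsub>M\<^esub> (\<lambda>i\<in>{..<n}. b \<odot>\<^bsub>M\<^esub> x i) i)"
      using a b x by (intro restrict_ext) (simp add: PiE_lessThan_mem smult_l_distr)
    show "(\<lambda>i\<in>{..<n}. (a \<otimes>\<^bsub>R\<^esub> b) \<odot>\<^bsub>M\<^esub> x i)
        = (\<lambda>i\<in>{..<n}. a \<odot>\<^bsub>M\<^esub> (\<lambda>i\<in>{..<n}. b \<odot>\<^bsub>M\<^esub> x i) i)"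
      using a b x by (intro restrict_ext) (simp add: PiE_lessThan_mem smult_assoc)
  next
    fix x assume "x \<in> {..<n} \<rightarrow>\<^sub>E carrier M"
    then show "(\<lambda>i\<in>{..<n}. \<one>\<^bsub>R\<^esub> \<odot>\<^bsub>M\<^esub> x i) = x"
      by (intro restrict_id) (simp_all add: PiE_lessThan_mem)
  qed
  ultimately show ?thesis
    by (simp add: left_module_def R.ring_axioms)
qed

text \<open>
  Finite sums in a power are evaluated coordinatewise by pushing them along this homomorphism.
\<close>

lemma mod_hom_coordinate: "i < n \<Longrightarrow> (\<lambda>x. x i) \<in> mod_hom R (module_power M n) M"
  by (rule mod_homI) auto

lemma left_module_regular: "ring R \<Longrightarrow> left_module R (regular_left_module R)"
proof -
  assume "ring R"
  then interpret ring R .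
  have "abelian_group (regular_left_module R)"
    by (rule abelian_groupI) (auto simp: regular_left_module_def a_ac intro: l_neg)
  then show ?thesis
    unfolding left_module_def left_module_axioms_def
    using ring_axioms by (auto simp: regular_left_module_def l_distr r_distr m_assoc)
qed

lemma regular_left_module_simps [simp]:
  "carrier (regular_left_module R) = carrier R"
  "\<zero>\<^bsub>regular_left_module R\<^esub> = \<zero>\<^bsub>R\<^esub>"
  "x \<oplus>\<^bsub>regular_left_module R\<^esub> y = x \<oplus>\<^bsub>R\<^esub> y"
  "a \<odot>\<^bsub>regular_left_module R\<^esub> x = a \<otimes>\<^bsub>R\<^esub> x"
  by (simp_all add: regular_left_module_def)

lemma left_module_free: "ring R \<Longrightarrow> left_module R (free_left_module R n)"
  by (intro left_module_power left_module_regular)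

text \<open>
  The linear map from a free module with prescribed values \<open>m i\<close> on the basis. Over the opposite
  ring \<open>M\<close> is a right module, and the value is the sum of the products \<open>m i x i\<close>.
\<close>

definition lincomb :: "('r, 'a, 'l) module_scheme \<Rightarrow> nat \<Rightarrow> (nat \<Rightarrow> 'a) \<Rightarrow> (nat \<Rightarrow> 'r) \<Rightarrow> 'a"
  where "lincomb M n m x = (\<Oplus>\<^bsub>M\<^esub>i\<in>{..<n}. x i \<odot>\<^bsub>M\<^esub> m i)"

definition unit_vector :: "('r, 'k) ring_scheme \<Rightarrow> nat \<Rightarrow> nat \<Rightarrow> nat \<Rightarrow> 'r"
  where "unit_vector R n j = (\<lambda>i\<in>{..<n}. if j = i then \<one>\<^bsub>R\<^esub> else \<zero>\<^bsub>R\<^esub>)"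

lemma unit_vector_closed [simp]: "ring R \<Longrightarrow> unit_vector R n j \<in> {..<n} \<rightarrow>\<^sub>E carrier R"
  by (auto simp: unit_vector_def ring.ring_simprules)

context left_module
begin

lemma smult_finsum:
  assumes "a \<in> carrier R" "f \<in> S \<rightarrow> carrier M"
  shows "a \<odot>\<^bsub>M\<^esub> finsum M f S = (\<Oplus>\<^bsub>M\<^esub>s\<in>S. a \<odot>\<^bsub>M\<^esub> f s)"
  using assms(2)
  by (induction S rule: infinite_finite_induct)
     (simp_all add: M.finsum_infinite assms(1) Pi_iff smult_r_distr)

lemma lincomb_hom:
  assumes m: "m \<in> {..<n} \<rightarrow> carrier M"
  shows "lincomb M n m \<in> mod_hom R (free_left_module R n) M"
proof (rule mod_homI)
  fix x y assume x: "x \<in> carrier (free_left_module R n)" and y: "y \<in> carrier (free_left_module R n)"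
  have "lincomb M n m (x \<oplus>\<^bsub>free_left_module R n\<^esub> y)
      = (\<Oplus>\<^bsub>M\<^esub>i\<in>{..<n}. x i \<odot>\<^bsub>M\<^esub> m i \<oplus>\<^bsub>M\<^esub> y i \<odot>\<^bsub>M\<^esub> m i)"
    unfolding lincomb_def
    using m x y by (intro M.finsum_cong') (auto simp: Pi_iff PiE_lessThan_mem smult_l_distr)
  also have "\<dots> = lincomb M n m x \<oplus>\<^bsub>M\<^esub> lincomb M n m y"
    unfolding lincomb_def using m x y by (intro M.finsum_addf) (auto simp: Pi_iff PiE_lessThan_mem)
  finally show "lincomb M n m (x \<oplus>\<^bsub>free_left_module R n\<^esub> y) = lincomb M n m x \<oplus>\<^bsub>M\<^esub> lincomb M n m y" .
next
  fix a x assume a: "a \<in> carrier R" and x: "x \<in> carrier (free_left_module R n)"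
  have "lincomb M n m (a \<odot>\<^bsub>free_left_module R n\<^esub> x) = (\<Oplus>\<^bsub>M\<^esub>i\<in>{..<n}. a \<odot>\<^bsub>M\<^esub> (x i \<odot>\<^bsub>M\<^esub> m i))"
    unfolding lincomb_def
    using m a x by (intro M.finsum_cong') (auto simp: Pi_iff PiE_lessThan_mem smult_assoc)
  also have "\<dots> = a \<odot>\<^bsub>M\<^esub> lincomb M n m x"
    unfolding lincomb_def using m a x by (intro smult_finsum[symmetric]) (auto simp: Pi_iff PiE_lessThan_mem)
  finally show "lincomb M n m (a \<odot>\<^bsub>free_left_module R n\<^esub> x) = a \<odot>\<^bsub>M\<^esub> lincomb M n m x" .
next
  fix x assume "x \<in> carrier (free_left_module R n)"
  then show "lincomb M n m x \<in> carrier M"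
    unfolding lincomb_def using m by (auto simp: Pi_iff PiE_lessThan_mem)
qed

lemma lincomb_unit_vector:
  assumes m: "m \<in> {..<n} \<rightarrow> carrier M" and j: "j < n"
  shows "lincomb M n m (unit_vector R n j) = m j"
proof -
  have "lincomb M n m (unit_vector R n j) = (\<Oplus>\<^bsub>M\<^esub>i\<in>{..<n}. if j = i then m i else \<zero>\<^bsub>M\<^esub>)"
    unfolding lincomb_def unit_vector_def
    using m by (intro M.finsum_cong') (auto simp: Pi_iff)
  also have "\<dots> = m j"
    using m j by (intro M.finsum_singleton) auto
  finally show ?thesis .
qed

lemma hom_from_free_eq_lincomb:
  assumes f: "f \<in> mod_hom R (free_left_module R n) M" and x: "x \<in> carrier (free_left_module R n)"
  shows "f x = lincomb M n (\<lambda>i. f (unit_vector R n i)) x"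
proof -
  interpret F: left_module R "free_left_module R n" by (rule left_module_free[OF R.ring_axioms])
  let ?e = "unit_vector R n"
  have e: "?e i \<in> carrier (free_left_module R n)" for i
    by (simp add: R.ring_axioms)
  \<comment> \<open>It suffices to expand \<open>x\<close> itself in the standard basis and to apply \<open>f\<close>.\<close>
  have x_eq: "x = lincomb (free_left_module R n) n ?e x"
  proof (rule PiE_ext[of _ "{..<n}" "\<lambda>_. carrier R"])
    show "lincomb (free_left_module R n) n ?e x \<in> {..<n} \<rightarrow>\<^sub>E carrier R"
      using mod_hom_closed[OF F.lincomb_hom[of ?e n] x] e by simp
    fix j assume "j \<in> {..<n}"
    then have j: "j < n" by simp
    interpret L: left_module R "regular_left_module R" by (rule left_module_regular[OF R.ring_axioms])
    have "lincomb (free_left_module R n) n ?e x j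
        = (\<Oplus>\<^bsub>regular_left_module R\<^esub>i\<in>{..<n}. (x i \<odot>\<^bsub>free_left_module R n\<^esub> ?e i) j)"
      unfolding lincomb_def
      using x e by (intro mod_hom_finsum[OF F.M.abelian_group_axioms L.M.abelian_group_axioms
          mod_hom_coordinate[OF j]] funcsetI F.smult_closed) auto
    also have "\<dots> = (\<Oplus>\<^bsub>regular_left_module R\<^esub>i\<in>{..<n}.
        if j = i then x i else \<zero>\<^bsub>regular_left_module R\<^esub>)"
      using x j R.ring_axioms by (intro L.M.finsum_cong') (auto simp: unit_vector_def PiE_lessThan_mem)
    also have "\<dots> = x j"
      using x j by (intro L.M.finsum_singleton) auto
    finally show "x j = lincomb (free_left_module R n) n ?e x j" by simp
  qed (use x in simp)
  have "f x = f (lincomb (free_left_module R n) n ?e x)"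
    by (rule arg_cong[OF x_eq])
  also have "\<dots> = (\<Oplus>\<^bsub>M\<^esub>i\<in>{..<n}. f (x i \<odot>\<^bsub>free_left_module R n\<^esub> ?e i))"
    unfolding lincomb_def
    using x e by (intro mod_hom_finsum[OF F.M.abelian_group_axioms M.abelian_group_axioms f]
        funcsetI F.smult_closed) auto
  also have "\<dots> = lincomb M n (\<lambda>i. f (?e i)) x"
    unfolding lincomb_def
    using x e mod_hom_closed[OF f]
    by (intro M.finsum_cong') (auto simp del: module_power_simps(4) simp: mod_hom_smult[OF f] PiE_lessThan_mem)
  finally show ?thesis .
qed

lemma hom_from_free_eqI:
  assumes "f \<in> mod_hom R (free_left_module R n) M" "g \<in> mod_hom R (free_left_module R n) M"
    and "\<And>i. i < n \<Longrightarrow> f (unit_vector R n i) = g (unit_vector R n i)"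
    and "x \<in> carrier (free_left_module R n)"
  shows "f x = g x"
proof -
  have "lincomb M n (\<lambda>i. f (unit_vector R n i)) x = lincomb M n (\<lambda>i. g (unit_vector R n i)) x"
    unfolding lincomb_def using assms mod_hom_closed[OF assms(2)] R.ring_axioms
    by (intro M.finsum_cong') (auto simp: PiE_lessThan_mem)
  then show ?thesis
    using hom_from_free_eq_lincomb assms by simp
qed

end

section \<open>Relative projectivity and powers\<close>

lemma mem_quotient_coset_iff:
  assumes "submodule X R M" "abelian_group M" "x \<in> carrier M"
  shows "z \<in> X +>\<^bsub>M\<^esub> x \<longleftrightarrow> z \<in> carrier M \<and> z \<ominus>\<^bsub>M\<^esub> x \<in> X"
proof -
  interpret M: abelian_group M by fact
  interpret submodule X R M by fact
  have sub: "X \<subseteq> carrier M" using subset by simp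
  show ?thesis
  proof
    assume "z \<in> X +>\<^bsub>M\<^esub> x"
    then obtain y where y: "y \<in> X" "z = y \<oplus>\<^bsub>M\<^esub> x" by (auto simp: a_r_coset_def')
    then have "z \<ominus>\<^bsub>M\<^esub> x = y"
      using sub assms(3) by (metis a_minus_def M.add.inv_solve_right' M.add.m_closed subsetD)
    then show "z \<in> carrier M \<and> z \<ominus>\<^bsub>M\<^esub> x \<in> X" using y sub assms(3) by auto
  next
    assume z: "z \<in> carrier M \<and> z \<ominus>\<^bsub>M\<^esub> x \<in> X"
    then have "z = (z \<ominus>\<^bsub>M\<^esub> x) \<oplus>\<^bsub>M\<^esub> x"
      using assms(3) by (simp add: a_minus_def M.a_assoc M.l_neg)
    then show "z \<in> X +>\<^bsub>M\<^esub> x" using z by (auto simp: a_r_coset_def')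
  qed
qed

lemma submoduleI:
  assumes "abelian_group M" "X \<subseteq> carrier M" "\<zero>\<^bsub>M\<^esub> \<in> X"
    and "\<And>x y. \<lbrakk>x \<in> X; y \<in> X\<rbrakk> \<Longrightarrow> x \<oplus>\<^bsub>M\<^esub> y \<in> X"
    and "\<And>x. x \<in> X \<Longrightarrow> \<ominus>\<^bsub>M\<^esub> x \<in> X"
    and "\<And>a x. \<lbrakk>a \<in> carrier R; x \<in> X\<rbrakk> \<Longrightarrow> a \<odot>\<^bsub>M\<^esub> x \<in> X"
  shows "submodule X R M"
proof -
  interpret abelian_group M by fact
  show ?thesis
    using assms(2-)
    by (intro submodule.intro subgroup.intro submodule_axioms.intro) (auto simp flip: a_inv_def)
qed

lemma submoduleD:
  assumes "submodule X R M" "abelian_group M"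
  shows "X \<subseteq> carrier M" "\<zero>\<^bsub>M\<^esub> \<in> X"
    and "\<And>x y. \<lbrakk>x \<in> X; y \<in> X\<rbrakk> \<Longrightarrow> x \<oplus>\<^bsub>M\<^esub> y \<in> X"
    and "\<And>x. x \<in> X \<Longrightarrow> \<ominus>\<^bsub>M\<^esub> x \<in> X"
    and "\<And>a x. \<lbrakk>a \<in> carrier R; x \<in> X\<rbrakk> \<Longrightarrow> a \<odot>\<^bsub>M\<^esub> x \<in> X"
proof -
  interpret M: abelian_group M by fact
  interpret submodule X R M by fact
  show "X \<subseteq> carrier M" "\<zero>\<^bsub>M\<^esub> \<in> X" using subset one_closed by simp_all
  show "\<And>x y. \<lbrakk>x \<in> X; y \<in> X\<rbrakk> \<Longrightarrow> x \<oplus>\<^bsub>M\<^esub> y \<in> X" using m_closed by simp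
  show "\<And>x. x \<in> X \<Longrightarrow> \<ominus>\<^bsub>M\<^esub> x \<in> X" using m_inv_closed by (simp add: a_inv_def)
  show "\<And>a x. \<lbrakk>a \<in> carrier R; x \<in> X\<rbrakk> \<Longrightarrow> a \<odot>\<^bsub>M\<^esub> x \<in> X" using smult_closed by simp
qed

lemma submodule_vimage:
  assumes M: "left_module R M" and M': "left_module R M'"
    and p: "p \<in> mod_hom R M M'" and N: "submodule N R M'"
  shows "submodule {x \<in> carrier M. p x \<in> N} R M"
proof -
  interpret M: left_module R M by fact
  interpret M': left_module R M' by fact
  note N_closed = submoduleD[OF N M'.M.abelian_group_axioms]
  show ?thesis
    using N_closed
      mod_hom_zero[OF M.M.abelian_group_axioms M'.M.abelian_group_axioms p]
      mod_hom_uminus[OF M.M.abelian_group_axioms M'.M.abelian_group_axioms p]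
    by (intro submoduleI M.M.abelian_group_axioms)
       (auto simp: mod_hom_add[OF p] mod_hom_smult[OF p])
qed

lemma submodule_image:
  assumes M: "left_module R M" and M': "left_module R M'" and p: "p \<in> mod_hom R M M'"
  shows "submodule (p ` carrier M) R M'"
proof -
  interpret M: left_module R M by fact
  interpret M': left_module R M' by fact
  show ?thesis
  proof (rule submoduleI[OF M'.M.abelian_group_axioms])
    have "p \<zero>\<^bsub>M\<^esub> \<in> p ` carrier M" by (rule imageI) simp
    then show "\<zero>\<^bsub>M'\<^esub> \<in> p ` carrier M"
      by (simp add: mod_hom_zero[OF M.M.abelian_group_axioms M'.M.abelian_group_axioms p])
  qed (auto simp: mod_hom_closed[OF p] simp flip: mod_hom_add[OF p] mod_hom_smult[OF p]
      mod_hom_uminus[OF M.M.abelian_group_axioms M'.M.abelian_group_axioms p])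
qed

text \<open>
  Projectivity of \<open>V\<close> relative to \<open>M\<close> speaks of quotients of \<open>M\<close> only, so the problem of lifting \<open>u\<close> modulo
  \<open>N\<close> is moved into \<open>M\<close>: with \<open>X\<close> the preimage of \<open>N\<close> under \<open>p\<close>, the solutions \<open>x\<close> for a given \<open>v\<close> form
  a coset of \<open>X\<close>, and sending \<open>v\<close> to this coset is a homomorphism to \<open>M/X\<close>.
\<close>

lemma rel_projective_lift_modulo:
  assumes M: "left_module R M" and V: "left_module R V" and M': "left_module R M'"
    and proj: "rel_projective R M V"
    and p: "p \<in> mod_hom R M M'" and u: "u \<in> mod_hom R V M'" and N: "submodule N R M'"
    and solvable: "\<And>v. v \<in> carrier V \<Longrightarrow> \<exists>x\<in>carrier M. u v \<ominus>\<^bsub>M'\<^esub> p x \<in> N"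
  shows "\<exists>h\<in>mod_hom R V M. \<forall>v\<in>carrier V. u v \<ominus>\<^bsub>M'\<^esub> p (h v) \<in> N"
proof -
  interpret M: left_module R M by fact
  interpret M': left_module R M' by fact
  interpret V: left_module R V by fact
  define X where "X = {x \<in> carrier M. p x \<in> N}"
  have X: "submodule X R M"
    unfolding X_def using submodule_vimage[OF M M' p N] .
  interpret X: abelian_subgroup X M
    using X by (intro abelian_subgroupI3 additive_subgroupI)
      (simp_all add: submodule_def M.M.abelian_group_axioms)
  note N_closed = submoduleD[OF N M'.M.abelian_group_axioms]
  note p_simps = mod_hom_closed[OF p] mod_hom_add[OF p] mod_hom_smult[OF p]
    mod_hom_minus[OF M.M.abelian_group_axioms M'.M.abelian_group_axioms p]
  note u_simps = mod_hom_closed[OF u] mod_hom_add[OF u] mod_hom_smult[OF u]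
  define g where "g v = {x \<in> carrier M. u v \<ominus>\<^bsub>M'\<^esub> p x \<in> N}" for v
  have coset: "g v = X +>\<^bsub>M\<^esub> x" if v: "v \<in> carrier V" and x: "x \<in> g v" for v x
  proof (rule Set.set_eqI)
    fix z
    have xc: "x \<in> carrier M" and xN: "u v \<ominus>\<^bsub>M'\<^esub> p x \<in> N" using x by (auto simp: g_def)
    have "(u v \<ominus>\<^bsub>M'\<^esub> p z \<in> N) = (p z \<ominus>\<^bsub>M'\<^esub> p x \<in> N)" if z: "z \<in> carrier M"
    proof -
      have c: "u v \<in> carrier M'" "p x \<in> carrier M'" "p z \<in> carrier M'"
        using v xc z by (simp_all add: p_simps u_simps)
      have "(u v \<ominus>\<^bsub>M'\<^esub> p x) \<oplus>\<^bsub>M'\<^esub> (p x \<ominus>\<^bsub>M'\<^esub> p z) = u v \<ominus>\<^bsub>M'\<^esub> p z"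
        and "(p z \<ominus>\<^bsub>M'\<^esub> u v) \<oplus>\<^bsub>M'\<^esub> (u v \<ominus>\<^bsub>M'\<^esub> p x) = p z \<ominus>\<^bsub>M'\<^esub> p x"
        using c by (simp_all add: M'.M.minus_telescope)
      then show ?thesis
        using xN N_closed(3,4) M'.M.uminus_minus_swap c by metis
    qed
    moreover have "z \<ominus>\<^bsub>M\<^esub> x \<in> X \<longleftrightarrow> p z \<ominus>\<^bsub>M'\<^esub> p x \<in> N" if z: "z \<in> carrier M"
      unfolding X_def using xc z by (simp add: p_simps)
    ultimately show "z \<in> g v \<longleftrightarrow> z \<in> X +>\<^bsub>M\<^esub> x"
      unfolding g_def mem_quotient_coset_iff[OF X M.M.abelian_group_axioms xc] by blast
  qed
  have ex: "\<exists>x. x \<in> g v" if "v \<in> carrier V" for v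
    using solvable[OF that] by (auto simp: g_def)
  have g_carrier: "g v \<subseteq> carrier M" for v by (auto simp: g_def)
  have g: "g \<in> mod_hom R V (quotient_module M X)"
  proof (rule mod_homI)
    fix v assume v: "v \<in> carrier V"
    obtain x where x: "x \<in> g v" using ex[OF v] ..
    show "g v \<in> carrier (quotient_module M X)"
      using coset[OF v x] x g_carrier by (auto simp: quotient_module_def A_RCOSETS_def')
  next
    fix v w assume v: "v \<in> carrier V" and w: "w \<in> carrier V"
    obtain x where x: "x \<in> g v" using ex[OF v] ..
    obtain y where y: "y \<in> g w" using ex[OF w] ..
    have c: "u v \<in> carrier M'" "p x \<in> carrier M'" "u w \<in> carrier M'" "p y \<in> carrier M'"
      using v w x y by (simp_all add: p_simps u_simps g_def)
    have "u (v \<oplus>\<^bsub>V\<^esub> w) \<ominus>\<^bsub>M'\<^esub> p (x \<oplus>\<^bsub>M\<^esub> y) = (u v \<ominus>\<^bsub>M'\<^esub> p x) \<oplus>\<^bsub>M'\<^esub> (u w \<ominus>\<^bsub>M'\<^esub> p y)"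
      using c v w x y
      by (simp add: a_minus_def M'.M.minus_add M'.M.a_ac p_simps u_simps g_def)
    then have xy: "x \<oplus>\<^bsub>M\<^esub> y \<in> g (v \<oplus>\<^bsub>V\<^esub> w)"
      using x y N_closed(3) by (simp add: g_def)
    have "x \<in> carrier M" "y \<in> carrier M"
      using x y g_carrier by auto
    then show "g (v \<oplus>\<^bsub>V\<^esub> w) = g v \<oplus>\<^bsub>quotient_module M X\<^esub> g w"
      using coset[OF v x] coset[OF w y] coset[OF _ xy] v w
      by (simp add: quotient_module_def X.a_rcos_sum)
  next
    fix a v assume a: "a \<in> carrier R" and v: "v \<in> carrier V"
    obtain x where x: "x \<in> g v" using ex[OF v] ..
    have ax: "a \<odot>\<^bsub>M\<^esub> y \<in> g (a \<odot>\<^bsub>V\<^esub> v)" if y: "y \<in> g v" for y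
    proof -
      have c: "u v \<in> carrier M'" "p y \<in> carrier M'"
        using v y by (simp_all add: p_simps u_simps g_def)
      have "u (a \<odot>\<^bsub>V\<^esub> v) \<ominus>\<^bsub>M'\<^esub> p (a \<odot>\<^bsub>M\<^esub> y) = a \<odot>\<^bsub>M'\<^esub> (u v \<ominus>\<^bsub>M'\<^esub> p y)"
        using a c v y
        by (simp add: a_minus_def p_simps u_simps g_def M'.smult_r_distr M'.smult_minus_right)
      then show ?thesis
        using y a N_closed(5) by (simp add: g_def)
    qed
    have "g (a \<odot>\<^bsub>V\<^esub> v) = X +>\<^bsub>M\<^esub> (a \<odot>\<^bsub>M\<^esub> y)" if "y \<in> g v" for y
      using coset[OF _ ax[OF that]] a v by simp
    then show "g (a \<odot>\<^bsub>V\<^esub> v) = a \<odot>\<^bsub>quotient_module M X\<^esub> g v"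
      using x by (auto simp: quotient_module_def)
  qed
  obtain h where h: "h \<in> mod_hom R V M" and gh: "\<And>v. v \<in> carrier V \<Longrightarrow> X +>\<^bsub>M\<^esub> h v = g v"
    using proj[unfolded rel_projective_def, rule_format, OF X g] by auto
  have "h v \<in> g v" if "v \<in> carrier V" for v
    using X.a_rcos_self[of "h v"] gh[OF that] mod_hom_closed[OF h that] by simp
  then show ?thesis
    using h by (auto simp: g_def)
qed

text \<open>
  Relative projectivity passes from \<open>M\<close> to the powers of \<open>M\<close>, with a homomorphism from a power written as
  a sum \<open>p 0 + \<dots> + p (n - 1)\<close>. Assuming \<open>u\<close> to take values in the range of the sum, instead of the sum
  to be surjective, is what the induction needs: after the last summand has been dealt with, the
  remaining ones cover \<open>N\<close> only.
\<close>

lemma rel_projective_lift_sum: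
  fixes n :: nat
  assumes M: "left_module R M" and V: "left_module R V" and M': "left_module R M'"
    and proj: "rel_projective R M V"
    and p: "\<And>i. i < n \<Longrightarrow> p i \<in> mod_hom R M M'" and u: "u \<in> mod_hom R V M'"
    and range: "\<And>v. v \<in> carrier V \<Longrightarrow> \<exists>x\<in>{..<n} \<rightarrow> carrier M. u v = (\<Oplus>\<^bsub>M'\<^esub>i\<in>{..<n}. p i (x i))"
  shows "\<exists>h. (\<forall>i<n. h i \<in> mod_hom R V M) \<and>
    (\<forall>v\<in>carrier V. u v = (\<Oplus>\<^bsub>M'\<^esub>i\<in>{..<n}. p i (h i v)))"
  using p u range
proof (induction n arbitrary: u)
  case 0
  interpret M': left_module R M' by fact
  show ?case using 0 by (intro exI[of _ undefined]) auto
next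
  case (Suc n)
  interpret M: left_module R M by fact
  interpret M': left_module R M' by fact
  interpret V: left_module R V by fact
  define s where "s x = (\<Oplus>\<^bsub>M'\<^esub>i\<in>{..<n}. p i (x i))" for x :: "nat \<Rightarrow> _"
  have pi: "p i \<in> mod_hom R M M'" if "i < Suc n" for i
    using Suc.prems(1) that by simp
  have pc: "p i y \<in> carrier M'" if "i < Suc n" "y \<in> carrier M" for i y
    using mod_hom_closed[OF pi] that by simp
  have split: "(\<Oplus>\<^bsub>M'\<^esub>i\<in>{..<Suc n}. p i (x i)) = p n (x n) \<oplus>\<^bsub>M'\<^esub> s x"
    if "x \<in> {..<Suc n} \<rightarrow> carrier M" for x
    using that pc unfolding s_def by (simp add: lessThan_Suc Pi_iff)
  have s: "s \<in> mod_hom R (module_power M n) M'"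
  proof (rule mod_homI)
    fix x y assume x: "x \<in> carrier (module_power M n)" and y: "y \<in> carrier (module_power M n)"
    have "s (x \<oplus>\<^bsub>module_power M n\<^esub> y) = (\<Oplus>\<^bsub>M'\<^esub>i\<in>{..<n}. p i (x i) \<oplus>\<^bsub>M'\<^esub> p i (y i))"
      unfolding s_def using x y pc
      by (intro M'.M.finsum_cong') (simp_all add: Pi_iff PiE_lessThan_mem mod_hom_add[OF pi])
    also have "\<dots> = s x \<oplus>\<^bsub>M'\<^esub> s y"
      unfolding s_def using x y pc
      by (intro M'.M.finsum_addf) (simp_all add: Pi_iff PiE_lessThan_mem)
    finally show "s (x \<oplus>\<^bsub>module_power M n\<^esub> y) = s x \<oplus>\<^bsub>M'\<^esub> s y" .
  next
    fix a x assume a: "a \<in> carrier R" and x: "x \<in> carrier (module_power M n)"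
    have "s (a \<odot>\<^bsub>module_power M n\<^esub> x) = (\<Oplus>\<^bsub>M'\<^esub>i\<in>{..<n}. a \<odot>\<^bsub>M'\<^esub> p i (x i))"
      unfolding s_def using a x pc
      by (intro M'.M.finsum_cong') (simp_all add: Pi_iff PiE_lessThan_mem mod_hom_smult[OF pi])
    also have "\<dots> = a \<odot>\<^bsub>M'\<^esub> s x"
      unfolding s_def using a x pc
      by (intro M'.smult_finsum[symmetric]) (simp_all add: Pi_iff PiE_lessThan_mem)
    finally show "s (a \<odot>\<^bsub>module_power M n\<^esub> x) = a \<odot>\<^bsub>M'\<^esub> s x" .
  qed (use pc in \<open>simp add: s_def Pi_iff PiE_lessThan_mem\<close>)
  have s_closed: "s x \<in> carrier M'" if "x \<in> {..<n} \<rightarrow> carrier M" for x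
    using that pc by (simp add: s_def Pi_iff)
  define N where "N = s ` carrier (module_power M n)"
  have N: "submodule N R M'"
    unfolding N_def by (rule submodule_image[OF left_module_power[OF M] M' s])
  have sN: "s x \<in> N" if x: "x \<in> {..<n} \<rightarrow> carrier M" for x
  proof -
    have "s x = s (restrict x {..<n})"
      unfolding s_def using pc x by (intro M'.M.finsum_cong') (simp_all add: Pi_iff)
    then show ?thesis using x unfolding N_def by auto
  qed
  have cancel: "(a \<oplus>\<^bsub>M'\<^esub> b) \<ominus>\<^bsub>M'\<^esub> a = b" if "a \<in> carrier M'" "b \<in> carrier M'" for a b
    using that by (simp add: a_minus_def M'.M.a_comm[of a b] M'.M.a_assoc M'.M.r_neg)
  have "\<exists>h\<in>mod_hom R V M. \<forall>v\<in>carrier V. u v \<ominus>\<^bsub>M'\<^esub> p n (h v) \<in> N"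
  proof (rule rel_projective_lift_modulo[OF M V M' proj _ Suc.prems(2) N])
    fix v assume "v \<in> carrier V"
    then obtain x where x: "x \<in> {..<Suc n} \<rightarrow> carrier M"
      and ux: "u v = (\<Oplus>\<^bsub>M'\<^esub>i\<in>{..<Suc n}. p i (x i))"
      using Suc.prems(3) by blast
    have "u v \<ominus>\<^bsub>M'\<^esub> p n (x n) = s x"
      unfolding ux split[OF x] using x pc s_closed by (intro cancel) (auto simp: Pi_iff)
    then show "\<exists>x\<in>carrier M. u v \<ominus>\<^bsub>M'\<^esub> p n x \<in> N"
      using sN[of x] x by (intro bexI[of _ "x n"]) (auto simp: Pi_iff)
  qed (use pi in simp)
  then obtain k where k: "k \<in> mod_hom R V M"
    and kN: "\<And>v. v \<in> carrier V \<Longrightarrow> u v \<ominus>\<^bsub>M'\<^esub> p n (k v) \<in> N" by blast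
  \<comment> \<open>What remains of \<open>u\<close> has values in the range of the first \<open>n\<close> summands.\<close>
  define u' where "u' v = u v \<ominus>\<^bsub>M'\<^esub> p n (k v)" for v
  have pk: "(\<lambda>v. p n (k v)) \<in> mod_hom R V M'"
    using mod_hom_comp[OF k pi] by simp
  note u_simps = mod_hom_closed[OF Suc.prems(2)] mod_hom_add[OF Suc.prems(2)] mod_hom_smult[OF Suc.prems(2)]
    mod_hom_closed[OF pk] mod_hom_add[OF pk] mod_hom_smult[OF pk]
  have u': "u' \<in> mod_hom R V M'"
    by (rule mod_homI)
       (simp_all add: u'_def u_simps a_minus_def M'.M.minus_add M'.M.a_ac M'.smult_r_distr
          M'.smult_minus_right)
  have "\<exists>h. (\<forall>i<n. h i \<in> mod_hom R V M) \<and>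
    (\<forall>v\<in>carrier V. u' v = (\<Oplus>\<^bsub>M'\<^esub>i\<in>{..<n}. p i (h i v)))"
  proof (rule Suc.IH[OF _ u'])
    fix v assume "v \<in> carrier V"
    then show "\<exists>x\<in>{..<n} \<rightarrow> carrier M. u' v = (\<Oplus>\<^bsub>M'\<^esub>i\<in>{..<n}. p i (x i))"
      using kN[of v] unfolding N_def u'_def s_def by fastforce
  qed (use pi in simp)
  then obtain h where h: "\<And>i. i < n \<Longrightarrow> h i \<in> mod_hom R V M"
    and uh: "\<And>v. v \<in> carrier V \<Longrightarrow> u' v = (\<Oplus>\<^bsub>M'\<^esub>i\<in>{..<n}. p i (h i v))" by blast
  define h' where "h' = h(n := k)"
  have h': "h' i \<in> mod_hom R V M" if "i < Suc n" for i
    using that h k by (auto simp: h'_def less_Suc_eq)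
  moreover have "u v = (\<Oplus>\<^bsub>M'\<^esub>i\<in>{..<Suc n}. p i (h' i v))" if v: "v \<in> carrier V" for v
  proof -
    have "s (\<lambda>i. h' i v) = u' v"
      unfolding s_def uh[OF v] using v pc mod_hom_closed[OF h]
      by (intro M'.M.finsum_cong') (simp_all add: h'_def)
    moreover have "u v = p n (k v) \<oplus>\<^bsub>M'\<^esub> u' v"
      unfolding u'_def using v by (simp add: u_simps a_minus_def M'.M.a_lcomm M'.M.r_neg)
    ultimately show ?thesis
      using split[of "\<lambda>i. h' i v"] v mod_hom_closed[OF h'] by (simp add: h'_def Pi_iff)
  qed
  ultimately show ?case by blast
qed

theorem rel_projective_lift_power:
  assumes M: "left_module R M" and V: "left_module R V" and M': "left_module R M'"
    and proj: "rel_projective R M V"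
    and p: "p \<in> mod_epi R (module_power M n) M'" and u: "u \<in> mod_hom R V M'"
  shows "\<exists>h\<in>mod_hom R V (module_power M n). \<forall>v\<in>carrier V. p (h v) = u v"
proof -
  interpret M: left_module R M by fact
  interpret M': left_module R M' by fact
  interpret P: left_module R "module_power M n" by (rule left_module_power[OF M])
  note pp = mod_epi_hom[OF p]
  \<comment> \<open>The coordinate embeddings split \<open>p\<close> into the sum of the homomorphisms \<open>p \<circ> e j\<close>.\<close>
  define e where "e j x = (\<lambda>i\<in>{..<n}. if j = i then x else \<zero>\<^bsub>M\<^esub>)" for j x
  have e: "e j \<in> mod_hom R M (module_power M n)" for j
    by (rule mod_homI) (auto simp: e_def)
  have decomp: "x = (\<Oplus>\<^bsub>module_power M n\<^esub>j\<in>{..<n}. e j (x j))"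
    if x: "x \<in> carrier (module_power M n)" for x
  proof (rule PiE_ext[of _ "{..<n}" "\<lambda>_. carrier M"])
    have ec: "(\<lambda>j. e j (x j)) \<in> {..<n} \<rightarrow> carrier (module_power M n)"
      using x mod_hom_closed[OF e] by (simp add: Pi_iff PiE_lessThan_mem)
    show "(\<Oplus>\<^bsub>module_power M n\<^esub>j\<in>{..<n}. e j (x j)) \<in> {..<n} \<rightarrow>\<^sub>E carrier M"
      using P.M.finsum_closed[OF ec] by simp
    fix i assume "i \<in> {..<n}"
    then have i: "i < n" by simp
    have "(\<Oplus>\<^bsub>module_power M n\<^esub>j\<in>{..<n}. e j (x j)) i = (\<Oplus>\<^bsub>M\<^esub>j\<in>{..<n}. e j (x j) i)"
      by (rule mod_hom_finsum[OF P.M.abelian_group_axioms M.M.abelian_group_axioms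
            mod_hom_coordinate[OF i] ec])
    also have "\<dots> = (\<Oplus>\<^bsub>M\<^esub>j\<in>{..<n}. if i = j then x j else \<zero>\<^bsub>M\<^esub>)"
      using x i by (intro M.M.finsum_cong') (auto simp: e_def PiE_lessThan_mem)
    also have "\<dots> = x i"
      using x i by (intro M.M.finsum_singleton) (auto simp: PiE_lessThan_mem)
    finally show "x i = (\<Oplus>\<^bsub>module_power M n\<^esub>j\<in>{..<n}. e j (x j)) i" by simp
  qed (use x in simp)
  have p_decomp: "p x = (\<Oplus>\<^bsub>M'\<^esub>j\<in>{..<n}. p (e j (x j)))"
    if x: "x \<in> carrier (module_power M n)" for x
  proof -
    have "p x = p (\<Oplus>\<^bsub>module_power M n\<^esub>j\<in>{..<n}. e j (x j))"
      by (rule arg_cong[OF decomp[OF x]])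
    also have "\<dots> = (\<Oplus>\<^bsub>M'\<^esub>j\<in>{..<n}. p (e j (x j)))"
      using x mod_hom_closed[OF e]
      by (intro mod_hom_finsum[OF P.M.abelian_group_axioms M'.M.abelian_group_axioms pp])
         (simp add: Pi_iff PiE_lessThan_mem)
    finally show ?thesis .
  qed
  have "\<exists>h. (\<forall>i<n. h i \<in> mod_hom R V M) \<and>
    (\<forall>v\<in>carrier V. u v = (\<Oplus>\<^bsub>M'\<^esub>i\<in>{..<n}. p (e i (h i v))))"
  proof (rule rel_projective_lift_sum[OF M V M' proj _ u])
    show "(\<lambda>x. p (e i x)) \<in> mod_hom R M M'" for i
      by (rule mod_hom_comp[OF e pp])
    fix v assume "v \<in> carrier V"
    then obtain x where x: "x \<in> carrier (module_power M n)" "p x = u v"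
      using mod_epi_surj[OF p] mod_hom_closed[OF u] by blast
    then show "\<exists>x\<in>{..<n} \<rightarrow> carrier M. u v = (\<Oplus>\<^bsub>M'\<^esub>i\<in>{..<n}. p (e i (x i)))"
      using p_decomp[OF x(1)] by (intro bexI[of _ x]) (auto simp: PiE_iff)
  qed
  then obtain h where h: "\<And>i. i < n \<Longrightarrow> h i \<in> mod_hom R V M"
    and uh: "\<And>v. v \<in> carrier V \<Longrightarrow> u v = (\<Oplus>\<^bsub>M'\<^esub>i\<in>{..<n}. p (e i (h i v)))" by blast
  define H where "H v = (\<lambda>i\<in>{..<n}. h i v)" for v
  have H: "H \<in> mod_hom R V (module_power M n)"
    using mod_hom_closed[OF h] mod_hom_add[OF h] mod_hom_smult[OF h]
    by (intro mod_homI) (simp_all add: H_def cong: restrict_cong)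
  have "p (H v) = u v" if v: "v \<in> carrier V" for v
    unfolding uh[OF v] p_decomp[OF mod_hom_closed[OF H v]]
    using v mod_hom_closed[OF h] mod_hom_closed[OF pp] mod_hom_closed[OF e]
    by (intro M'.M.finsum_cong') (simp_all add: H_def)
  then show ?thesis using H by blast
qed

section \<open>Right modules as left modules over the opposite ring\<close>

text \<open>
  The constructions for left modules (powers, free modules, linear combinations) serve right modules
  through this ring.
\<close>

definition opposite_ring :: "('r, 'k) ring_scheme \<Rightarrow> ('r, 'k) ring_scheme"
  where "opposite_ring R = R\<lparr>monoid.mult := \<lambda>x y. y \<otimes>\<^bsub>R\<^esub> x\<rparr>"

lemma opposite_ring_simps [simp]:
  "carrier (opposite_ring R) = carrier R" "\<zero>\<^bsub>opposite_ring R\<^esub> = \<zero>\<^bsub>R\<^esub>" "\<one>\<^bsub>opposite_ring R\<^esub> = \<one>\<^bsub>R\<^esub>"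
  "x \<oplus>\<^bsub>opposite_ring R\<^esub> y = x \<oplus>\<^bsub>R\<^esub> y" "x \<otimes>\<^bsub>opposite_ring R\<^esub> y = y \<otimes>\<^bsub>R\<^esub> x"
  by (simp_all add: opposite_ring_def)

lemma opposite_opposite_ring [simp]: "opposite_ring (opposite_ring R) = R"
  by (simp add: opposite_ring_def)

lemma ring_opposite:
  assumes "ring R"
  shows "ring (opposite_ring R)"
proof -
  interpret ring R by fact
  have "abelian_group (opposite_ring R)"
    by (rule abelian_groupI) (auto simp: a_ac intro: l_neg)
  moreover have "monoid (opposite_ring R)"
    by (rule monoidI) (simp_all add: m_assoc)
  ultimately show ?thesis
    by (rule ringI) (simp_all add: l_distr r_distr)
qed

lemma right_module_iff_opposite: "right_module R A \<longleftrightarrow> left_module (opposite_ring R) A"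
proof -
  have "ring (opposite_ring R) \<longleftrightarrow> ring R"
    using ring_opposite[of R] ring_opposite[of "opposite_ring R"] by auto
  then show ?thesis
    unfolding left_module_def right_module_def left_module_axioms_def right_module_axioms_def
    by auto
qed

section \<open>The relations defining the tensor product\<close>

lemma tensor_generators_keys:
  assumes A: "right_module R A" and V: "left_module R V"
  shows "({frag_of (x \<oplus>\<^bsub>A\<^esub> y, v) - frag_of (x, v) - frag_of (y, v) | x y v.
        x \<in> carrier A \<and> y \<in> carrier A \<and> v \<in> carrier V} \<union>
     {frag_of (x, v \<oplus>\<^bsub>V\<^esub> w) - frag_of (x, v) - frag_of (x, w) | x v w.
        x \<in> carrier A \<and> v \<in> carrier V \<and> w \<in> carrier V} \<union>
     {frag_of (a \<odot>\<^bsub>A\<^esub> x, v) - frag_of (x, a \<odot>\<^bsub>V\<^esub> v) | x a v.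
        x \<in> carrier A \<and> a \<in> carrier R \<and> v \<in> carrier V})
    \<subseteq> carrier (free_Abelian_group (carrier A \<times> carrier V))"
proof -
  interpret A: right_module R A by fact
  interpret V: left_module R V by fact
  show ?thesis
    by (auto dest!: subsetD[OF keys_diff])
qed

lemma subgroup_tensor_rels:
  assumes "right_module R A" "left_module R V"
  shows "subgroup (tensor_rels R A V) (free_Abelian_group (carrier A \<times> carrier V))"
  unfolding tensor_rels_def
  by (rule group.generate_is_subgroup[OF group_free_Abelian_group tensor_generators_keys[OF assms]])

lemma tensor_rels_keys:
  assumes "right_module R A" "left_module R V" "c \<in> tensor_rels R A V"
  shows "Poly_Mapping.keys c \<subseteq> carrier A \<times> carrier V"
  using subgroup.mem_carrier[OF subgroup_tensor_rels[OF assms(1,2)] assms(3)] by simp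

lemma tensor_rels_zero: "0 \<in> tensor_rels R A V"
  unfolding tensor_rels_def
  using generate.one[of "free_Abelian_group (carrier A \<times> carrier V)"] by simp

lemma tensor_rels_plus:
  "\<lbrakk>c \<in> tensor_rels R A V; d \<in> tensor_rels R A V\<rbrakk> \<Longrightarrow> c + d \<in> tensor_rels R A V"
  unfolding tensor_rels_def
  using generate.eng[of _ "free_Abelian_group (carrier A \<times> carrier V)"] by simp

lemma tensor_rels_uminus:
  assumes "right_module R A" "left_module R V" "c \<in> tensor_rels R A V"
  shows "- c \<in> tensor_rels R A V"
  using subgroup.m_inv_closed[OF subgroup_tensor_rels[OF assms(1,2)] assms(3)]
    tensor_rels_keys[OF assms] by simp

lemma tensor_rels_minus:
  "\<lbrakk>right_module R A; left_module R V; c \<in> tensor_rels R A V; d \<in> tensor_rels R A V\<rbrakk>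
    \<Longrightarrow> c - d \<in> tensor_rels R A V"
  using tensor_rels_plus[of c R A V "- d"] tensor_rels_uminus by fastforce

lemma tensor_rels_sum:
  "(\<And>j. j \<in> J \<Longrightarrow> c j \<in> tensor_rels R A V) \<Longrightarrow> sum c J \<in> tensor_rels R A V"
  by (induction J rule: infinite_finite_induct) (auto intro: tensor_rels_zero tensor_rels_plus)

lemma tensor_rels_add_left:
  "\<lbrakk>x \<in> carrier A; y \<in> carrier A; v \<in> carrier V\<rbrakk>
    \<Longrightarrow> frag_of (x \<oplus>\<^bsub>A\<^esub> y, v) - frag_of (x, v) - frag_of (y, v) \<in> tensor_rels R A V"
  unfolding tensor_rels_def by (rule generate.incl) blast

lemma tensor_rels_add_right:
  "\<lbrakk>x \<in> carrier A; v \<in> carrier V; w \<in> carrier V\<rbrakk>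
    \<Longrightarrow> frag_of (x, v \<oplus>\<^bsub>V\<^esub> w) - frag_of (x, v) - frag_of (x, w) \<in> tensor_rels R A V"
  unfolding tensor_rels_def by (rule generate.incl) blast

lemma tensor_rels_smult:
  "\<lbrakk>x \<in> carrier A; a \<in> carrier R; v \<in> carrier V\<rbrakk>
    \<Longrightarrow> frag_of (a \<odot>\<^bsub>A\<^esub> x, v) - frag_of (x, a \<odot>\<^bsub>V\<^esub> v) \<in> tensor_rels R A V"
  unfolding tensor_rels_def by (rule generate.incl) blast

text \<open>
  To show that a homomorphism from the free abelian group maps the relations into a subgroup, it
  suffices to look at the three kinds of generators.
\<close>

lemma tensor_rels_induct [consumes 3, case_names zero plus uminus add_left add_right smult]:
  assumes A: "right_module R A" and V: "left_module R V" and c: "c \<in> tensor_rels R A V"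
    and zero: "P 0"
    and plus: "\<And>c d. \<lbrakk>c \<in> tensor_rels R A V; d \<in> tensor_rels R A V; P c; P d\<rbrakk> \<Longrightarrow> P (c + d)"
    and uminus: "\<And>c. \<lbrakk>c \<in> tensor_rels R A V; P c\<rbrakk> \<Longrightarrow> P (- c)"
    and add_left: "\<And>x y v. \<lbrakk>x \<in> carrier A; y \<in> carrier A; v \<in> carrier V\<rbrakk>
      \<Longrightarrow> P (frag_of (x \<oplus>\<^bsub>A\<^esub> y, v) - frag_of (x, v) - frag_of (y, v))"
    and add_right: "\<And>x v w. \<lbrakk>x \<in> carrier A; v \<in> carrier V; w \<in> carrier V\<rbrakk>
      \<Longrightarrow> P (frag_of (x, v \<oplus>\<^bsub>V\<^esub> w) - frag_of (x, v) - frag_of (x, w))"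
    and smult: "\<And>x a v. \<lbrakk>x \<in> carrier A; a \<in> carrier R; v \<in> carrier V\<rbrakk>
      \<Longrightarrow> P (frag_of (a \<odot>\<^bsub>A\<^esub> x, v) - frag_of (x, a \<odot>\<^bsub>V\<^esub> v))"
  shows "P c"
proof -
  have "c \<in> tensor_rels R A V \<and> P c"
    using c[unfolded tensor_rels_def]
  proof (induction rule: generate.induct)
    case one
    then show ?case using zero tensor_rels_zero by simp
  next
    case (incl h)
    then show ?case
      using add_left add_right smult
      by (auto intro: tensor_rels_add_left tensor_rels_add_right tensor_rels_smult)
  next
    case (inv h)
    have "P h"
      using inv add_left add_right smult by blast
    moreover have "h \<in> tensor_rels R A V"
      unfolding tensor_rels_def using inv by (rule generate.incl)
    ultimately show ?case
      using uminus tensor_rels_uminus[OF A V] tensor_rels_keys[OF A V] by simp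
  next
    case (eng h1 h2)
    then show ?case by (auto intro: plus tensor_rels_plus)
  qed
  then show ?thesis ..
qed

text \<open>
  Flatness without cosets: an element of the free abelian group that represents zero in \<open>B \<otimes> V\<close> after
  applying \<open>f\<close> already represents zero in \<open>A \<otimes> V\<close>. Indeed \<open>f \<otimes> id\<close> takes the cosets of \<open>c\<close> and of \<open>0\<close> to the
  zero coset.
\<close>

lemma flat_reflects_tensor_zero:
  fixes A B :: "('r, 'a) module"
  assumes flat: "flat TYPE('a) R V"
    and A: "right_module R A" and B: "right_module R B" and V: "left_module R V"
    and f: "f \<in> mod_hom R A B" and inj: "inj_on f (carrier A)"
    and c: "Poly_Mapping.keys c \<subseteq> carrier A \<times> carrier V"
    and Fc: "frag_extend (\<lambda>(x, v). frag_of (f x, v)) c \<in> tensor_rels R B V"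
  shows "c \<in> tensor_rels R A V"
proof -
  let ?F = "frag_extend (\<lambda>(x, v). frag_of (f x, v))"
  let ?GA = "free_Abelian_group (carrier A \<times> carrier V)"
  let ?GB = "free_Abelian_group (carrier B \<times> carrier V)"
  note TB = subgroup_tensor_rels[OF B V]
  have F_rels: "?F d \<in> tensor_rels R B V" if "d \<in> tensor_rels R A V" for d
    using A V that
  proof (induction rule: tensor_rels_induct)
    case (add_left x y v)
    then show ?case
      by (simp add: frag_extend_diff mod_hom_add[OF f] mod_hom_closed[OF f] tensor_rels_add_left)
  next
    case (add_right x v w)
    then show ?case
      by (simp add: frag_extend_diff mod_hom_closed[OF f] tensor_rels_add_right)
  next
    case (smult x a v)
    then show ?case
      by (simp add: frag_extend_diff mod_hom_smult[OF f] mod_hom_closed[OF f] tensor_rels_smult)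
  qed (simp_all add: frag_extend_add frag_extend_minus tensor_rels_zero tensor_rels_plus
      tensor_rels_uminus[OF B V])
  \<comment> \<open>The union in the definition of the tensor map runs over a nonempty set of equal cosets.\<close>
  have kills: "tensor_map R B V f (tensor_rels R A V #>\<^bsub>?GA\<^esub> d) = tensor_rels R B V"
    if d: "?F d \<in> tensor_rels R B V" for d
  proof -
    have "tensor_rels R B V #>\<^bsub>?GB\<^esub> ?F e = tensor_rels R B V"
      if e: "e \<in> tensor_rels R A V #>\<^bsub>?GA\<^esub> d" for e
    proof -
      obtain t where t: "t \<in> tensor_rels R A V" "e = t + d"
        using e by (auto simp: r_coset_def)
      then have "?F e \<in> tensor_rels R B V"
        using F_rels d by (simp add: frag_extend_add tensor_rels_plus)
      then show ?thesis
        by (rule subgroup.rcos_const[OF TB group_free_Abelian_group])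
    qed
    moreover have "tensor_rels R A V #>\<^bsub>?GA\<^esub> d \<noteq> {}"
      using tensor_rels_zero by (auto simp: r_coset_def)
    ultimately show ?thesis
      unfolding tensor_map_def by simp
  qed
  have inj_tensor: "inj_on (tensor_map R B V f) (carrier (tensor_product R A V))"
    using flat A B f inj unfolding flat_def by blast
  have coset: "tensor_rels R A V #>\<^bsub>?GA\<^esub> d \<in> carrier (tensor_product R A V)"
    if "Poly_Mapping.keys d \<subseteq> carrier A \<times> carrier V" for d
    using that by (auto simp: tensor_product_def FactGroup_def RCOSETS_def)
  have "tensor_rels R A V #>\<^bsub>?GA\<^esub> c = tensor_rels R A V #>\<^bsub>?GA\<^esub> 0"
  proof (rule inj_onD[OF inj_tensor _ coset coset])
    show "tensor_map R B V f (tensor_rels R A V #>\<^bsub>?GA\<^esub> c)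
        = tensor_map R B V f (tensor_rels R A V #>\<^bsub>?GA\<^esub> 0)"
      using kills[OF Fc] kills[of 0] tensor_rels_zero[of R B V] by simp
  qed (use c in simp_all)
  moreover have "c \<in> tensor_rels R A V #>\<^bsub>?GA\<^esub> c"
    using tensor_rels_zero[of R A V] by (force simp: r_coset_def)
  ultimately show ?thesis
    by (auto simp: r_coset_def)
qed

lemma tensor_rels_finsum_left:
  assumes A: "right_module R A" and V: "left_module R V"
    and g: "g \<in> S \<rightarrow> carrier A" and v: "v \<in> carrier V" and fin: "finite S"
  shows "frag_of (finsum A g S, v) - (\<Sum>s\<in>S. frag_of (g s, v)) \<in> tensor_rels R A V"
proof -
  interpret A: right_module R A by fact
  show ?thesis
    using fin g
  proof (induction S)
    case empty
    have "- frag_of (\<zero>\<^bsub>A\<^esub>, v) \<in> tensor_rels R A V"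
      using tensor_rels_add_left[of "\<zero>\<^bsub>A\<^esub>" A "\<zero>\<^bsub>A\<^esub>" v V] v by simp
    then show ?case
      using tensor_rels_uminus[OF A V] by fastforce
  next
    case (insert s S)
    then have "g s \<in> carrier A" "finsum A g S \<in> carrier A" "g \<in> S \<rightarrow> carrier A" by auto
    then show ?case
      using insert tensor_rels_plus[OF insert.IH tensor_rels_add_left[of "g s" A "finsum A g S" v V R]] v
      by (simp add: algebra_simps)
  qed
qed

lemma tensor_rels_finsum_right:
  assumes A: "right_module R A" and V: "left_module R V"
    and g: "g \<in> S \<rightarrow> carrier V" and x: "x \<in> carrier A" and fin: "finite S"
  shows "frag_of (x, finsum V g S) - (\<Sum>s\<in>S. frag_of (x, g s)) \<in> tensor_rels R A V"
proof -
  interpret V: left_module R V by fact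
  show ?thesis
    using fin g
  proof (induction S)
    case empty
    have "- frag_of (x, \<zero>\<^bsub>V\<^esub>) \<in> tensor_rels R A V"
      using tensor_rels_add_right[of x A "\<zero>\<^bsub>V\<^esub>" V "\<zero>\<^bsub>V\<^esub>"] x by simp
    then show ?case
      using tensor_rels_uminus[OF A V] by fastforce
  next
    case (insert s S)
    then have "g s \<in> carrier V" "finsum V g S \<in> carrier V" "g \<in> S \<rightarrow> carrier V" by auto
    then show ?case
      using insert tensor_rels_plus[OF insert.IH tensor_rels_add_right[of x A "g s" V "finsum V g S" R]] x
      by (simp add: algebra_simps)
  qed
qed

text \<open>
  The computation
  \<open>\<Sum>\<^sub>j (\<Sum>\<^sub>i x\<^sub>i a\<^sub>i\<^sub>j) \<otimes> v\<^sub>j = \<Sum>\<^sub>j \<Sum>\<^sub>i x\<^sub>i \<otimes> a\<^sub>i\<^sub>j v\<^sub>j = \<Sum>\<^sub>i x\<^sub>i \<otimes> (\<Sum>\<^sub>j a\<^sub>i\<^sub>j v\<^sub>j) = 0\<close>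
  in the tensor product, carried out on representatives.
\<close>

lemma tensor_rels_of_relations:
  fixes m n :: nat
  assumes A: "right_module R A" and V: "left_module R V"
    and a: "\<And>i j. \<lbrakk>i < m; j < n\<rbrakk> \<Longrightarrow> a i j \<in> carrier R"
    and x: "\<And>i. i < m \<Longrightarrow> x i \<in> carrier A" and v: "\<And>j. j < n \<Longrightarrow> v j \<in> carrier V"
    and rel: "\<And>i. i < m \<Longrightarrow> (\<Oplus>\<^bsub>V\<^esub>j\<in>{..<n}. a i j \<odot>\<^bsub>V\<^esub> v j) = \<zero>\<^bsub>V\<^esub>"
  shows "(\<Sum>j<n. frag_of (\<Oplus>\<^bsub>A\<^esub>i\<in>{..<m}. a i j \<odot>\<^bsub>A\<^esub> x i, v j)) \<in> tensor_rels R A V"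
proof -
  interpret A: right_module R A by fact
  interpret V: left_module R V by fact
  note minus = tensor_rels_minus[OF A V]
  have 1: "(\<Sum>j<n. frag_of (\<Oplus>\<^bsub>A\<^esub>i\<in>{..<m}. a i j \<odot>\<^bsub>A\<^esub> x i, v j)
      - (\<Sum>i<m. frag_of (a i j \<odot>\<^bsub>A\<^esub> x i, v j))) \<in> tensor_rels R A V"
    using a x v by (intro tensor_rels_sum tensor_rels_finsum_left[OF A V]) auto
  have 2: "(\<Sum>j<n. \<Sum>i<m. frag_of (a i j \<odot>\<^bsub>A\<^esub> x i, v j) - frag_of (x i, a i j \<odot>\<^bsub>V\<^esub> v j))
      \<in> tensor_rels R A V"
    using a x v by (intro tensor_rels_sum tensor_rels_smult) auto
  have "frag_of (x i, \<Oplus>\<^bsub>V\<^esub>j\<in>{..<n}. a i j \<odot>\<^bsub>V\<^esub> v j) - (\<Sum>j<n. frag_of (x i, a i j \<odot>\<^bsub>V\<^esub> v j))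
      \<in> tensor_rels R A V" if "i < m" for i
    using a x v that by (intro tensor_rels_finsum_right[OF A V]) auto
  moreover have "frag_of (x i, \<zero>\<^bsub>V\<^esub>) \<in> tensor_rels R A V" if "i < m" for i
    using tensor_rels_finsum_right[OF A V, of "\<lambda>_. \<zero>\<^bsub>V\<^esub>" "{}" "x i"] x[OF that] by simp
  ultimately have "(\<Sum>j<n. frag_of (x i, a i j \<odot>\<^bsub>V\<^esub> v j)) \<in> tensor_rels R A V" if "i < m" for i
    using minus[of "frag_of (x i, \<zero>\<^bsub>V\<^esub>)"
        "frag_of (x i, \<zero>\<^bsub>V\<^esub>) - (\<Sum>j<n. frag_of (x i, a i j \<odot>\<^bsub>V\<^esub> v j))"] that rel
    by simp
  then have "(\<Sum>i<m. \<Sum>j<n. frag_of (x i, a i j \<odot>\<^bsub>V\<^esub> v j)) \<in> tensor_rels R A V"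
    by (rule tensor_rels_sum) simp
  then have 3: "(\<Sum>j<n. \<Sum>i<m. frag_of (x i, a i j \<odot>\<^bsub>V\<^esub> v j)) \<in> tensor_rels R A V"
    by (subst sum.swap)
  show ?thesis
    using tensor_rels_plus[OF tensor_rels_plus[OF 1 2] 3] by (simp add: sum_subtractf)
qed

section \<open>Vanishing tensors over a flat module\<close>

text \<open>
  The module axioms are equations, apart from the existence of inverses, and the image of an inverse
  is an inverse of the image; so they pass to the image of a module under any map that respects the
  operations.
\<close>

lemma left_module_epi_image:
  assumes F: "left_module R F" and h: "h \<in> mod_epi R F N" and zero: "h \<zero>\<^bsub>F\<^esub> = \<zero>\<^bsub>N\<^esub>"
  shows "left_module R N"
proof -
  interpret F: left_module R F by fact
  have hom: "h \<in> mod_hom R F N" using mod_epi_hom[OF h] .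
  have N: "carrier N = h ` carrier F" using h by (simp add: mod_epi_def)
  note simps = mod_hom_add[OF hom, symmetric] mod_hom_smult[OF hom, symmetric] zero[symmetric]
  have "abelian_group N"
  proof (rule abelian_groupI)
    fix x assume "x \<in> carrier N"
    then obtain y where y: "y \<in> carrier F" "x = h y" unfolding N by blast
    then have "h (\<ominus>\<^bsub>F\<^esub> y) \<oplus>\<^bsub>N\<^esub> x = \<zero>\<^bsub>N\<^esub>"
      by (simp add: simps F.M.l_neg)
    then show "\<exists>y\<in>carrier N. y \<oplus>\<^bsub>N\<^esub> x = \<zero>\<^bsub>N\<^esub>"
      unfolding N using y by blast
  qed (auto simp: N simps F.M.a_ac)
  then show ?thesis
    unfolding left_module_def left_module_axioms_def
    by (auto simp: F.R.ring_axioms N simps F.smult_l_distr F.smult_r_distr F.smult_assoc)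
qed

lemma (in abelian_group) finsum_lessThan_add:
  fixes k l :: nat
  assumes "s \<in> {..<k} \<rightarrow> carrier G" "t \<in> {..<l} \<rightarrow> carrier G"
  shows "(\<Oplus>i\<in>{..<k + l}. if i < k then s i else t (i - k))
    = (\<Oplus>i\<in>{..<k}. s i) \<oplus> (\<Oplus>i\<in>{..<l}. t i)"
  using assms(2)
proof (induction l)
  case 0
  then show ?case
    using assms(1) by (simp cong: finsum_cong') (rule finsum_cong', auto)
next
  case (Suc l)
  then show ?case
    using assms(1) by (subst add_Suc_right) (simp add: lessThan_Suc Pi_iff a_lcomm)
qed

text \<open>
  Since \<open>S\<close> is closed under negation, the inverses that generate a subgroup can be absorbed into \<open>S\<close>.
\<close>

lemma generate_imp_finsum:
  assumes W: "abelian_group W" and S: "S \<subseteq> carrier W" and neg: "\<And>s. s \<in> S \<Longrightarrow> \<ominus>\<^bsub>W\<^esub> s \<in> S"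
    and x: "x \<in> generate (add_monoid W) S"
  shows "\<exists>(k :: nat) s. s \<in> {..<k} \<rightarrow> S \<and> x = finsum W s {..<k}"
  using x
proof (induction rule: generate.induct)
  case one
  interpret abelian_group W by fact
  show ?case by (intro exI[of _ 0]) auto
next
  case (incl h)
  interpret abelian_group W by fact
  show ?case
    using incl S by (intro exI[of _ "1::nat"] exI[of _ "\<lambda>_. h"]) (auto simp: lessThan_Suc)
next
  case (inv h)
  interpret abelian_group W by fact
  have "\<ominus>\<^bsub>W\<^esub> h \<in> S" "inv\<^bsub>add_monoid W\<^esub> h = \<ominus>\<^bsub>W\<^esub> h"
    using neg inv by (auto simp: a_inv_def)
  then show ?case
    using S by (intro exI[of _ "1::nat"] exI[of _ "\<lambda>_. \<ominus>\<^bsub>W\<^esub> h"]) (auto simp: lessThan_Suc)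
next
  case (eng x y)
  interpret abelian_group W by fact
  obtain k l :: nat and s t where s: "s \<in> {..<k} \<rightarrow> S" "x = finsum W s {..<k}"
    and t: "t \<in> {..<l} \<rightarrow> S" "y = finsum W t {..<l}"
    using eng.IH by blast
  have "x \<oplus>\<^bsub>W\<^esub> y = (\<Oplus>\<^bsub>W\<^esub>i\<in>{..<k + l}. if i < k then s i else t (i - k))"
    using s t S by (subst finsum_lessThan_add) (auto simp: Pi_iff)
  moreover have "(\<lambda>i. if i < k then s i else t (i - k)) \<in> {..<k + l} \<rightarrow> S"
    using s t by (auto simp: Pi_iff)
  ultimately show ?case by auto
qed

lemma hom_free_Abelian_group_sum:
  assumes W: "abelian_group W" and \<Phi>: "\<Phi> \<in> hom (free_Abelian_group S) (add_monoid W)"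
    and g: "g \<in> J \<rightarrow> S" and fin: "finite J"
  shows "\<Phi> (\<Sum>j\<in>J. frag_of (g j)) = (\<Oplus>\<^bsub>W\<^esub>j\<in>J. \<Phi> (frag_of (g j)))"
proof -
  interpret abelian_group W by fact
  have \<Phi>_add: "\<Phi> (c + d) = \<Phi> c \<oplus>\<^bsub>W\<^esub> \<Phi> d" if "Poly_Mapping.keys c \<subseteq> S" "Poly_Mapping.keys d \<subseteq> S" for c d
    using hom_mult[OF \<Phi>, of c d] that by simp
  have \<Phi>_closed: "\<Phi> c \<in> carrier W" if "Poly_Mapping.keys c \<subseteq> S" for c
    using hom_in_carrier[OF \<Phi>, of c] that by simp
  show ?thesis
    using fin g
  proof (induction J)
    case empty
    then show ?case using hom_one[OF \<Phi> group_free_Abelian_group] a_group by simp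
  next
    case (insert j J)
    have "(\<Sum>j\<in>J. frag_of (g j)) \<in> carrier (free_Abelian_group S)"
      using insert.prems by (intro sum_closed_free_Abelian_group) auto
    then show ?case
      using insert by (simp add: \<Phi>_add \<Phi>_closed Pi_iff)
  qed
qed

text \<open>
  This is exactness of \<open>K \<otimes> V \<rightarrow> R\<^sup>n \<otimes> V \<rightarrow> A \<otimes> V\<close>, where \<open>A\<close> is the span of the \<open>y j\<close> and \<open>K\<close> the
  kernel of \<open>R\<^sup>n \<rightarrow> A\<close>; flatness is needed to pass from \<open>B\<close> to \<open>A\<close>. Here \<open>R\<^sup>n \<otimes> V\<close> is \<open>V\<^sup>n\<close>, and the
  image of \<open>K \<otimes> V\<close> is the subgroup \<open>L\<close> generated by the tuples \<open>(b\<^sub>j w)\<^sub>j\<close> with \<open>b\<close> in \<open>K\<close>. A section \<open>s\<close> of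
  \<open>R\<^sup>n \<rightarrow> A\<close>, chosen as a mere function, defines a map \<open>\<Phi>\<close> from the free abelian group on
  \<open>A \<times> V\<close> to \<open>V\<^sup>n\<close>. The section is linear up to elements of \<open>K\<close>, so \<open>\<Phi>\<close> maps the relations of the tensor product
  into \<open>L\<close>. As \<open>s (y j)\<close> differs from the \<open>j\<close>-th basis vector by an element of \<open>K\<close>, the image of
  \<open>\<Sum>\<^sub>j y\<^sub>j \<otimes> v\<^sub>j\<close> under \<open>\<Phi>\<close> is congruent to \<open>(v\<^sub>j)\<^sub>j\<close> modulo \<open>L\<close>.
\<close>

lemma flat_tensor_zero_imp_relations:
  fixes B :: "('r, 'a) module" and n :: nat
  assumes flat: "flat TYPE('a) R V" and V: "left_module R V" and B: "right_module R B"
    and y: "y \<in> {..<n} \<rightarrow> carrier B" and v: "v \<in> {..<n} \<rightarrow> carrier V"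
    and zero: "(\<Sum>j<n. frag_of (y j, v j)) \<in> tensor_rels R B V"
  shows "\<exists>(k :: nat) b w. (\<forall>l<k. b l \<in> {..<n} \<rightarrow>\<^sub>E carrier R \<and> lincomb B n y (b l) = \<zero>\<^bsub>B\<^esub> \<and> w l \<in> carrier V) \<and>
    (\<forall>j<n. v j = (\<Oplus>\<^bsub>V\<^esub>l\<in>{..<k}. b l j \<odot>\<^bsub>V\<^esub> w l))"
proof -
  interpret V: left_module R V by fact
  let ?R' = "opposite_ring R"
  let ?F = "free_left_module ?R' n"
  let ?W = "module_power V n"
  have R': "ring ?R'" by (rule ring_opposite[OF V.R.ring_axioms])
  interpret B: left_module ?R' B using B by (simp add: right_module_iff_opposite)
  interpret F: left_module ?R' ?F by (rule left_module_free[OF R'])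
  interpret W: left_module R ?W by (rule left_module_power[OF V])
  let ?\<phi> = "lincomb B n y"
  have \<phi>: "?\<phi> \<in> mod_hom ?R' ?F B" by (rule B.lincomb_hom[OF y])
  \<comment> \<open>The submodule of \<open>B\<close> spanned by the \<open>y j\<close>.\<close>
  define A where "A = B\<lparr>carrier := ?\<phi> ` carrier ?F\<rparr>"
  have A_simps: "carrier A = ?\<phi> ` carrier ?F" "\<zero>\<^bsub>A\<^esub> = \<zero>\<^bsub>B\<^esub>" "(\<oplus>\<^bsub>A\<^esub>) = (\<oplus>\<^bsub>B\<^esub>)" "(\<odot>\<^bsub>A\<^esub>) = (\<odot>\<^bsub>B\<^esub>)"
    by (simp_all add: A_def)
  have \<phi>A: "?\<phi> \<in> mod_epi ?R' ?F A"
    using \<phi> unfolding mod_epi_def mod_hom_def A_simps by blast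
  have "left_module ?R' A"
  proof (rule left_module_epi_image[OF F.left_module_axioms \<phi>A])
    show "?\<phi> \<zero>\<^bsub>?F\<^esub> = \<zero>\<^bsub>A\<^esub>"
      using mod_hom_zero[OF F.M.abelian_group_axioms B.M.abelian_group_axioms \<phi>] by (simp add: A_simps)
  qed
  then interpret A: left_module ?R' A .
  have A: "right_module R A"
    using A.left_module_axioms by (simp add: right_module_iff_opposite)
  have yA: "y j \<in> carrier A" if "j < n" for j
    unfolding A_simps
  proof (rule image_eqI)
    show "y j = ?\<phi> (unit_vector ?R' n j)" using B.lincomb_unit_vector[OF y that] by simp
    show "unit_vector ?R' n j \<in> carrier ?F" using unit_vector_closed[OF R', of n j] by simp
  qed
  let ?c = "\<Sum>j<n. frag_of (y j, v j)"
  have c: "?c \<in> tensor_rels R A V"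
  proof (rule flat_reflects_tensor_zero[OF flat A B V])
    show "(\<lambda>x. x) \<in> mod_hom R A B"
      using mod_hom_closed[OF \<phi>] by (intro mod_homI) (auto simp: A_simps)
    have "?c \<in> carrier (free_Abelian_group (carrier A \<times> carrier V))"
      using yA v by (intro sum_closed_free_Abelian_group) auto
    then show "Poly_Mapping.keys ?c \<subseteq> carrier A \<times> carrier V" by simp
    have frag_of_eta: "(\<lambda>(x, v). frag_of (x, v)) = frag_of" by auto
    show "frag_extend (\<lambda>(x, v). frag_of (x, v)) ?c \<in> tensor_rels R B V"
      unfolding frag_of_eta frag_expansion[symmetric] by (rule zero)
  qed simp
  \<comment> \<open>The tensor \<open>b \<otimes> w\<close> under the identification of \<open>R\<^sup>n \<otimes> V\<close> with \<open>V\<^sup>n\<close>.\<close>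
  define bw where "bw b w = (\<lambda>j\<in>{..<n}. b j \<odot>\<^bsub>V\<^esub> w)" for b :: "nat \<Rightarrow> 'r" and w
  have bw_closed: "bw b w \<in> carrier ?W" if "b \<in> carrier ?F" "w \<in> carrier V" for b w
    using that by (simp add: bw_def PiE_lessThan_mem)
  have bw_add_left: "bw (b \<oplus>\<^bsub>?F\<^esub> b') w = bw b w \<oplus>\<^bsub>?W\<^esub> bw b' w"
    if "b \<in> carrier ?F" "b' \<in> carrier ?F" "w \<in> carrier V" for b b' w
    using that unfolding bw_def module_power_simps
    by (intro restrict_ext) (simp add: PiE_lessThan_mem V.smult_l_distr)
  have bw_add_right: "bw b (w \<oplus>\<^bsub>V\<^esub> w') = bw b w \<oplus>\<^bsub>?W\<^esub> bw b w'"
    if "b \<in> carrier ?F" "w \<in> carrier V" "w' \<in> carrier V" for b w w'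
    using that unfolding bw_def module_power_simps
    by (intro restrict_ext) (simp add: PiE_lessThan_mem V.smult_r_distr)
  have bw_smult: "bw (a \<odot>\<^bsub>?F\<^esub> b) w = bw b (a \<odot>\<^bsub>V\<^esub> w)"
    if "a \<in> carrier R" "b \<in> carrier ?F" "w \<in> carrier V" for a b w
    using that unfolding bw_def module_power_simps
    by (intro restrict_ext) (simp add: PiE_lessThan_mem V.smult_assoc)
  have bw_uminus: "bw b (\<ominus>\<^bsub>V\<^esub> w) = \<ominus>\<^bsub>?W\<^esub> bw b w" if "b \<in> carrier ?F" "w \<in> carrier V" for b w
  proof -
    have "bw b (\<ominus>\<^bsub>V\<^esub> w) \<oplus>\<^bsub>?W\<^esub> bw b w = \<zero>\<^bsub>?W\<^esub>"
      using that unfolding bw_def module_power_simps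
      by (intro restrict_ext) (simp add: PiE_lessThan_mem V.smult_minus_right V.M.l_neg)
    then show ?thesis
      using bw_closed that by (metis W.M.minus_equality V.M.a_inv_closed)
  qed
  define S where "S = {bw b w | b w. b \<in> carrier ?F \<and> ?\<phi> b = \<zero>\<^bsub>B\<^esub> \<and> w \<in> carrier V}"
  have S: "S \<subseteq> carrier ?W"
    using bw_closed by (auto simp: S_def)
  have S_neg: "\<ominus>\<^bsub>?W\<^esub> s \<in> S" if s_S: "s \<in> S" for s
  proof -
    obtain b w where b: "b \<in> carrier ?F" "?\<phi> b = \<zero>\<^bsub>B\<^esub>" and w: "w \<in> carrier V" and s: "s = bw b w"
      using s_S unfolding S_def by blast
    have "\<ominus>\<^bsub>?W\<^esub> s = bw b (\<ominus>\<^bsub>V\<^esub> w)"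
      unfolding s by (rule bw_uminus[OF b(1) w, symmetric])
    then show ?thesis
      unfolding S_def mem_Collect_eq using b V.M.a_inv_closed[OF w]
      by (intro exI[of _ b] exI[of _ "\<ominus>\<^bsub>V\<^esub> w"] conjI)
  qed
  define L where "L = generate (add_monoid ?W) S"
  interpret L: additive_subgroup L ?W
    unfolding L_def
    using group.generate_is_subgroup[OF W.M.a_group, of S] S by (intro additive_subgroupI) simp
  \<comment> \<open>Modulo \<open>L\<close>, the tuple \<open>bw b w\<close> depends only on the image of \<open>b\<close> in the span.\<close>
  have in_L: "bw b w \<ominus>\<^bsub>?W\<^esub> bw b' w \<in> L"
    if b: "b \<in> carrier ?F" "b' \<in> carrier ?F" and w: "w \<in> carrier V" and eq: "?\<phi> b = ?\<phi> b'" for b b' w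
  proof -
    let ?d = "b \<ominus>\<^bsub>?F\<^esub> b'"
    have d: "?d \<in> carrier ?F" using b by (rule F.M.minus_closed)
    have "?\<phi> ?d = ?\<phi> b \<ominus>\<^bsub>B\<^esub> ?\<phi> b'"
      by (rule mod_hom_minus[OF F.M.abelian_group_axioms B.M.abelian_group_axioms \<phi> b])
    then have "?\<phi> ?d = \<zero>\<^bsub>B\<^esub>"
      using eq mod_hom_closed[OF \<phi>] b B.M.minus_eq_zero_iff by metis
    then have "bw ?d w \<in> L"
      unfolding L_def S_def using d w by (intro generate.incl) blast
    moreover have "?d \<oplus>\<^bsub>?F\<^esub> b' = b"
      using b by (rule F.M.minus_add_cancel)
    then have "bw b w = bw ?d w \<oplus>\<^bsub>?W\<^esub> bw b' w"
      using bw_add_left[OF d b(2) w] by metis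
    then have "bw b w \<ominus>\<^bsub>?W\<^esub> bw b' w = bw ?d w"
      using W.M.add_minus_cancel[OF bw_closed[OF d w] bw_closed[OF b(2) w]] by (simp only:)
    ultimately show ?thesis by simp
  qed
  have "\<forall>x\<in>carrier A. \<exists>b. b \<in> carrier ?F \<and> ?\<phi> b = x"
    unfolding A_simps(1) by blast
  then obtain s where "\<forall>x\<in>carrier A. s x \<in> carrier ?F \<and> ?\<phi> (s x) = x"
    by (rule bchoice[THEN exE])
  then have s: "s x \<in> carrier ?F" "?\<phi> (s x) = x" if "x \<in> carrier A" for x
    using that by blast+
  have "(\<lambda>(x, w). bw (s x) w) ` (carrier A \<times> carrier V) \<subseteq> carrier (add_monoid ?W)"
    using bw_closed[OF s(1)] by (auto simp del: module_power_simps)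
  then obtain \<Phi> where \<Phi>: "\<Phi> \<in> hom (free_Abelian_group (carrier A \<times> carrier V)) (add_monoid ?W)"
    and \<Phi>_of': "\<And>z. z \<in> carrier A \<times> carrier V \<Longrightarrow> \<Phi> (frag_of z) = (case z of (x, w) \<Rightarrow> bw (s x) w)"
    using comm_group.free_Abelian_group_universal[OF W.M.a_comm_group] by blast
  have \<Phi>_of: "\<Phi> (frag_of (x, w)) = bw (s x) w" if "x \<in> carrier A" "w \<in> carrier V" for x w
    using \<Phi>_of'[of "(x, w)"] that by simp
  let ?ok = "\<lambda>c :: _ \<Rightarrow>\<^sub>0 int. Poly_Mapping.keys c \<subseteq> carrier A \<times> carrier V"
  have ok_of: "?ok (frag_of (x, w))" if "x \<in> carrier A" "w \<in> carrier V" for x w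
    using that by (simp add: keys_frag_of)
  have ok_diff: "?ok (c - d)" if "?ok c" "?ok d" for c d
    using that keys_diff[of c d] by blast
  have \<Phi>_add: "\<Phi> (c + d) = \<Phi> c \<oplus>\<^bsub>?W\<^esub> \<Phi> d" if "?ok c" "?ok d" for c d
    using hom_mult[OF \<Phi>, of c d] that by simp
  have \<Phi>_uminus: "\<Phi> (- c) = \<ominus>\<^bsub>?W\<^esub> \<Phi> c" if "?ok c" for c
    using group_hom.hom_inv[of "free_Abelian_group (carrier A \<times> carrier V)" "add_monoid ?W" \<Phi> c] that \<Phi>
      W.M.a_group by (simp add: group_hom_def group_hom_axioms_def a_inv_def)
  have \<Phi>_diff: "\<Phi> (c - d) = \<Phi> c \<ominus>\<^bsub>?W\<^esub> \<Phi> d" if "?ok c" "?ok d" for c d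
    using \<Phi>_add[of c "- d"] \<Phi>_uminus[of d] that by (simp add: a_minus_def)
  have \<Phi>_L: "\<Phi> d \<in> L" if "d \<in> tensor_rels R A V" for d
    using A V that
  proof (induction rule: tensor_rels_induct)
    case zero
    have "\<Phi> 0 = \<zero>\<^bsub>?W\<^esub>"
      using hom_one[OF \<Phi> group_free_Abelian_group] W.M.a_group by simp
    then show ?case using L.zero_closed by metis
  next
    case (plus c d)
    then show ?case
      using \<Phi>_add tensor_rels_keys[OF A V] L.a_closed by metis
  next
    case (uminus c)
    then show ?case
      using \<Phi>_uminus tensor_rels_keys[OF A V] L.a_inv_closed W.M.abelian_group_axioms by metis
  next
    case (add_left x x' w)
    have xx: "x \<oplus>\<^bsub>A\<^esub> x' \<in> carrier A" using add_left by simp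
    have c: "bw (s (x \<oplus>\<^bsub>A\<^esub> x')) w \<in> carrier ?W" "bw (s x) w \<in> carrier ?W" "bw (s x') w \<in> carrier ?W"
      using bw_closed s(1) add_left xx by blast+
    have "\<Phi> (frag_of (x \<oplus>\<^bsub>A\<^esub> x', w) - frag_of (x, w) - frag_of (x', w))
        = bw (s (x \<oplus>\<^bsub>A\<^esub> x')) w \<ominus>\<^bsub>?W\<^esub> bw (s x) w \<ominus>\<^bsub>?W\<^esub> bw (s x') w"
      using add_left xx by (simp only: \<Phi>_diff ok_diff ok_of \<Phi>_of)
    also have "\<dots> = bw (s (x \<oplus>\<^bsub>A\<^esub> x')) w \<ominus>\<^bsub>?W\<^esub> (bw (s x) w \<oplus>\<^bsub>?W\<^esub> bw (s x') w)"
      using c by (simp add: a_minus_def W.M.minus_add W.M.a_assoc del: module_power_simps)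
    also have "\<dots> = bw (s (x \<oplus>\<^bsub>A\<^esub> x')) w \<ominus>\<^bsub>?W\<^esub> bw (s x \<oplus>\<^bsub>?F\<^esub> s x') w"
      using add_left s(1) by (simp only: bw_add_left)
    also have "\<dots> \<in> L"
    proof (rule in_L)
      show "?\<phi> (s (x \<oplus>\<^bsub>A\<^esub> x')) = ?\<phi> (s x \<oplus>\<^bsub>?F\<^esub> s x')"
        using add_left xx s by (simp add: mod_hom_add[OF \<phi>] A_simps del: module_power_simps)
    qed (use add_left xx s(1) F.M.a_closed in blast)+
    finally show ?case .
  next
    case (add_right x w w')
    have c: "bw (s x) w \<in> carrier ?W" "bw (s x) w' \<in> carrier ?W"
      using bw_closed s(1) add_right by blast+
    have "\<Phi> (frag_of (x, w \<oplus>\<^bsub>V\<^esub> w') - frag_of (x, w) - frag_of (x, w'))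
        = bw (s x) (w \<oplus>\<^bsub>V\<^esub> w') \<ominus>\<^bsub>?W\<^esub> bw (s x) w \<ominus>\<^bsub>?W\<^esub> bw (s x) w'"
      using add_right by (simp only: \<Phi>_diff ok_diff ok_of \<Phi>_of V.M.a_closed)
    also have "\<dots> = \<zero>\<^bsub>?W\<^esub>"
      using c s(1) add_right
      by (simp add: bw_add_right a_minus_def W.M.a_ac W.M.r_neg W.M.r_neg1 W.M.r_neg2 del: module_power_simps)
    finally show ?case using L.zero_closed by metis
  next
    case (smult x a w)
    have ax: "a \<odot>\<^bsub>A\<^esub> x \<in> carrier A" "a \<odot>\<^bsub>V\<^esub> w \<in> carrier V" using smult by simp_all
    have "\<Phi> (frag_of (a \<odot>\<^bsub>A\<^esub> x, w) - frag_of (x, a \<odot>\<^bsub>V\<^esub> w))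
        = bw (s (a \<odot>\<^bsub>A\<^esub> x)) w \<ominus>\<^bsub>?W\<^esub> bw (s x) (a \<odot>\<^bsub>V\<^esub> w)"
      using smult ax by (simp only: \<Phi>_diff ok_of \<Phi>_of)
    also have "\<dots> = bw (s (a \<odot>\<^bsub>A\<^esub> x)) w \<ominus>\<^bsub>?W\<^esub> bw (a \<odot>\<^bsub>?F\<^esub> s x) w"
      using smult s(1) by (simp only: bw_smult)
    also have "\<dots> \<in> L"
    proof (rule in_L)
      show "?\<phi> (s (a \<odot>\<^bsub>A\<^esub> x)) = ?\<phi> (a \<odot>\<^bsub>?F\<^esub> s x)"
        using smult ax s by (simp add: mod_hom_smult[OF \<phi>] A_simps del: module_power_simps)
      show "a \<odot>\<^bsub>?F\<^esub> s x \<in> carrier ?F"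
        using smult s(1) by (intro F.smult_closed) auto
    qed (use smult ax s(1) in blast)+
    finally show ?case .
  qed
  let ?e = "unit_vector ?R' n"
  have e: "?e j \<in> carrier ?F" for j using unit_vector_closed[OF R', of n j] by simp
  have vj: "v j \<in> carrier V" if "j < n" for j using v that by auto
  define d where "d j = bw (?e j) (v j) \<ominus>\<^bsub>?W\<^esub> bw (s (y j)) (v j)" for j
  have d: "d j \<in> L" if "j < n" for j
    unfolding d_def using e s yA vj that B.lincomb_unit_vector[OF y that]
    by (intro in_L) simp_all
  have d_sum: "finsum ?W d {..<m} \<in> L" if "m \<le> n" for m
    using that
  proof (induction m)
    case 0
    then show ?case using L.zero_closed by (simp del: module_power_simps)
  next
    case (Suc m)
    have "d \<in> {..<m} \<rightarrow> carrier ?W" "d m \<in> carrier ?W"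
      using d L.a_Hcarr Suc.prems by (auto simp del: module_power_simps)
    then have "finsum ?W d {..<Suc m} = d m \<oplus>\<^bsub>?W\<^esub> finsum ?W d {..<m}"
      by (simp add: lessThan_Suc del: module_power_simps)
    moreover have "d m \<in> L" using d[of m] Suc.prems by simp
    ultimately show ?case using Suc L.a_closed[of "d m" "finsum ?W d {..<m}"] by (simp del: module_power_simps)
  qed
  have \<Phi>_c: "\<Phi> ?c = (\<Oplus>\<^bsub>?W\<^esub>j\<in>{..<n}. bw (s (y j)) (v j))"
  proof -
    have "\<Phi> ?c = (\<Oplus>\<^bsub>?W\<^esub>j\<in>{..<n}. \<Phi> (frag_of (y j, v j)))"
      using yA vj by (intro hom_free_Abelian_group_sum[OF W.M.abelian_group_axioms \<Phi>]) auto
    also have "\<dots> = (\<Oplus>\<^bsub>?W\<^esub>j\<in>{..<n}. bw (s (y j)) (v j))"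
      using yA vj bw_closed s(1) by (intro W.M.finsum_cong') (simp_all add: \<Phi>_of del: module_power_simps)
    finally show ?thesis .
  qed
  have bwe: "bw (?e j) (v j) \<in> carrier ?W" "bw (s (y j)) (v j) \<in> carrier ?W" if "j < n" for j
    using bw_closed e vj[OF that] s(1)[OF yA[OF that]] by blast+
  \<comment> \<open>The left-hand side is the tuple \<open>(v j)\<^sub>j\<close>; both summands on the right lie in \<open>L\<close>.\<close>
  have sum_e: "(\<Oplus>\<^bsub>?W\<^esub>j\<in>{..<n}. bw (?e j) (v j)) = finsum ?W d {..<n} \<oplus>\<^bsub>?W\<^esub> \<Phi> ?c"
  proof -
    have "(\<Oplus>\<^bsub>?W\<^esub>j\<in>{..<n}. bw (?e j) (v j)) = (\<Oplus>\<^bsub>?W\<^esub>j\<in>{..<n}. d j \<oplus>\<^bsub>?W\<^esub> bw (s (y j)) (v j))"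
    proof (rule W.M.finsum_cong')
      show "bw (?e j) (v j) = d j \<oplus>\<^bsub>?W\<^esub> bw (s (y j)) (v j)" if "j \<in> {..<n}" for j
        unfolding d_def a_minus_def using bwe[of j] that
        by (simp add: W.M.a_assoc W.M.l_neg del: module_power_simps)
    qed (use d L.a_Hcarr bwe in \<open>auto simp del: module_power_simps intro!: W.M.a_closed\<close>)
    also have "\<dots> = finsum ?W d {..<n} \<oplus>\<^bsub>?W\<^esub> (\<Oplus>\<^bsub>?W\<^esub>j\<in>{..<n}. bw (s (y j)) (v j))"
      using d L.a_Hcarr bwe by (intro W.M.finsum_addf) (auto simp del: module_power_simps)
    finally show ?thesis by (simp only: \<Phi>_c)
  qed
  then have "(\<Oplus>\<^bsub>?W\<^esub>j\<in>{..<n}. bw (?e j) (v j)) \<in> generate (add_monoid ?W) S"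
    using L.a_closed[OF d_sum[OF order_refl] \<Phi>_L[OF c]] unfolding L_def by (simp only:)
  then obtain k :: nat and t where t: "t \<in> {..<k} \<rightarrow> S"
    and sum_t: "(\<Oplus>\<^bsub>?W\<^esub>j\<in>{..<n}. bw (?e j) (v j)) = finsum ?W t {..<k}"
    using generate_imp_finsum[OF W.M.abelian_group_axioms S S_neg] by blast
  have "\<exists>b w. l < k \<longrightarrow> b \<in> carrier ?F \<and> ?\<phi> b = \<zero>\<^bsub>B\<^esub> \<and> w \<in> carrier V \<and> t l = bw b w" for l
  proof (cases "l < k")
    case True
    then have "t l \<in> S" using t by auto
    then show ?thesis unfolding S_def by blast
  qed simp
  then obtain b w where bw_l: "\<And>l. l < k \<Longrightarrow>
      b l \<in> carrier ?F \<and> ?\<phi> (b l) = \<zero>\<^bsub>B\<^esub> \<and> w l \<in> carrier V \<and> t l = bw (b l) (w l)"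
    by metis
  have "v i = (\<Oplus>\<^bsub>V\<^esub>l\<in>{..<k}. b l i \<odot>\<^bsub>V\<^esub> w l)" if i: "i < n" for i
  proof -
    note coord = mod_hom_finsum[OF W.M.abelian_group_axioms V.M.abelian_group_axioms
        mod_hom_coordinate[OF i]]
    have "(\<Oplus>\<^bsub>?W\<^esub>j\<in>{..<n}. bw (?e j) (v j)) i = (\<Oplus>\<^bsub>V\<^esub>j\<in>{..<n}. bw (?e j) (v j) i)"
      using bwe(1) by (intro coord) auto
    also have "\<dots> = (\<Oplus>\<^bsub>V\<^esub>j\<in>{..<n}. if i = j then v j else \<zero>\<^bsub>V\<^esub>)"
      using i vj by (intro V.M.finsum_cong') (auto simp: bw_def unit_vector_def)
    also have "\<dots> = v i"
      using i v by (intro V.M.finsum_singleton) auto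
    finally have "v i = finsum ?W t {..<k} i"
      by (simp only: sum_t)
    also have "\<dots> = (\<Oplus>\<^bsub>V\<^esub>l\<in>{..<k}. t l i)"
      using t S by (intro coord) blast
    also have "\<dots> = (\<Oplus>\<^bsub>V\<^esub>l\<in>{..<k}. b l i \<odot>\<^bsub>V\<^esub> w l)"
      using bw_l i by (intro V.M.finsum_cong') (auto simp: bw_def PiE_lessThan_mem)
    finally show ?thesis .
  qed
  then show ?thesis
    using bw_l by (intro exI[of _ k] exI[of _ b] exI[of _ w]) simp
qed

section \<open>Homomorphisms from finitely presented to flat modules\<close>

text \<open>
  An isomorphic copy of \<open>M\<close> on singletons. It carries a module with elements in \<open>'a\<close> over to the type
  \<open>'a set\<close>, in particular the right module \<open>R\<^sup>m\<close> to the type \<open>(nat \<Rightarrow> 'r) set\<close> on which flatness is tested.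
\<close>

definition singleton_module :: "('r, 'a, 'l) module_scheme \<Rightarrow> ('r, 'a set) module"
  where "singleton_module M =
    \<lparr>carrier = (\<lambda>x. {x}) ` carrier M, mult = undefined, one = undefined, zero = {\<zero>\<^bsub>M\<^esub>},
     add = (\<lambda>X Y. {the_elem X \<oplus>\<^bsub>M\<^esub> the_elem Y}), smult = (\<lambda>a X. {a \<odot>\<^bsub>M\<^esub> the_elem X})\<rparr>"

lemma singleton_mod_epi: "(\<lambda>x. {x}) \<in> mod_epi R M (singleton_module M)"
  by (simp add: mod_epi_def mod_hom_def singleton_module_def)

lemma left_module_singleton: "left_module R M \<Longrightarrow> left_module R (singleton_module M)"
  by (rule left_module_epi_image[OF _ singleton_mod_epi]) (simp_all add: singleton_module_def)

text \<open>
  A ring and its opposite have the same addition.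
\<close>

lemma finsum_regular_opposite:
  "finsum (regular_left_module (opposite_ring R)) = finsum (regular_left_module R)"
  by (simp add: finsum_def regular_left_module_def opposite_ring_def fun_eq_iff)

lemma hom_from_free_lift:
  assumes M: "left_module R M" and M': "left_module R M'"
    and p: "p \<in> mod_epi R M M'" and g: "g \<in> mod_hom R (free_left_module R k) M'"
  shows "\<exists>h\<in>mod_hom R (free_left_module R k) M. \<forall>x\<in>carrier (free_left_module R k). p (h x) = g x"
proof -
  interpret M: left_module R M by fact
  interpret M': left_module R M' by fact
  have e: "unit_vector R k i \<in> carrier (free_left_module R k)" for i
    by (simp add: M.R.ring_axioms)
  have "\<forall>i. \<exists>m. m \<in> carrier M \<and> p m = g (unit_vector R k i)"
    using mod_epi_surj[OF p mod_hom_closed[OF g e]] by blast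
  then obtain m where "\<forall>i. m i \<in> carrier M \<and> p (m i) = g (unit_vector R k i)"
    by (rule choice[THEN exE])
  then have m: "m \<in> {..<k} \<rightarrow> carrier M" and pm: "\<And>i. p (m i) = g (unit_vector R k i)"
    by auto
  note h = M.lincomb_hom[OF m]
  have "p (lincomb M k m x) = g x" if "x \<in> carrier (free_left_module R k)" for x
  proof (rule M'.hom_from_free_eqI[OF mod_hom_comp[OF h mod_epi_hom[OF p]] g _ that])
    show "p (lincomb M k m (unit_vector R k i)) = g (unit_vector R k i)" if "i < k" for i
      using M.lincomb_unit_vector[OF m that] pm by simp
  qed
  then show ?thesis using h by blast
qed

text \<open>
  The criterion of Lazard and Govorov, in one direction. Row \<open>i\<close> of the presentation matrix is \<open>a i\<close>, the
  image of a basis vector in \<open>R\<^sup>n\<close>, and \<open>v j\<close> is the image of a basis vector of \<open>R\<^sup>n\<close> in \<open>V\<close>. Once \<open>b\<close> and \<open>w\<close>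
  are found, \<open>\<beta>\<close> has the values \<open>w l\<close> on the basis of \<open>R\<^sup>k\<close>, and the map \<open>R\<^sup>n \<rightarrow> R\<^sup>k\<close> with the values
  \<open>(b l j)\<^sub>l\<close> kills the image of \<open>R\<^sup>m\<close> and so descends to \<open>G\<close>.
\<close>

theorem flat_hom_from_finitely_presented_factors:
  fixes R :: "('r, 'k) ring_scheme"
  assumes flat: "flat TYPE((nat \<Rightarrow> 'r) set) R V" and V: "left_module R V" and G: "left_module R G"
    and fp: "finitely_presented R G" and g: "g \<in> mod_hom R G V"
  shows "\<exists>k. \<exists>\<alpha>\<in>mod_hom R G (free_left_module R k). \<exists>\<beta>\<in>mod_hom R (free_left_module R k) V.
    \<forall>x\<in>carrier G. g x = \<beta> (\<alpha> x)"
proof -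
  interpret V: left_module R V by fact
  interpret G: left_module R G by fact
  have ring: "ring R" by (rule V.R.ring_axioms)
  obtain m n f h where f: "f \<in> mod_hom R (free_left_module R m) (free_left_module R n)"
    and h: "h \<in> mod_epi R (free_left_module R n) G"
    and exact: "f ` carrier (free_left_module R m) = a_kernel (free_left_module R n) G h"
    using fp unfolding finitely_presented_def by blast
  let ?Fm = "free_left_module R m" and ?Fn = "free_left_module R n"
  interpret Fm: left_module R ?Fm by (rule left_module_free[OF ring])
  interpret Fn: left_module R ?Fn by (rule left_module_free[OF ring])
  have em: "unit_vector R m i \<in> carrier ?Fm" for i using ring by simp
  have en: "unit_vector R n i \<in> carrier ?Fn" for i using ring by simp
  note hh = mod_epi_hom[OF h]
  have ker: "h x = \<zero>\<^bsub>G\<^esub> \<longleftrightarrow> x \<in> f ` carrier ?Fm" if "x \<in> carrier ?Fn" for x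
    unfolding exact a_kernel_def' using that by simp
  define a where "a i = f (unit_vector R m i)" for i
  have a: "a i \<in> carrier ?Fn" for i
    unfolding a_def using mod_hom_closed[OF f em] .
  define v where "v j = g (h (unit_vector R n j))" for j
  have v: "v j \<in> carrier V" for j
    unfolding v_def using mod_hom_closed[OF g] mod_hom_closed[OF hh] en by blast
  note gh = mod_hom_comp[OF hh g]
  have gh_lincomb: "g (h x) = lincomb V n v x" if "x \<in> carrier ?Fn" for x
    using V.hom_from_free_eq_lincomb[OF gh that] unfolding v_def .
  have rel: "(\<Oplus>\<^bsub>V\<^esub>j\<in>{..<n}. a i j \<odot>\<^bsub>V\<^esub> v j) = \<zero>\<^bsub>V\<^esub>" for i
  proof -
    have "h (a i) = \<zero>\<^bsub>G\<^esub>"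
      using ker[OF a] em unfolding a_def by blast
    then show ?thesis
      using gh_lincomb[OF a, of i] mod_hom_zero[OF G.M.abelian_group_axioms V.M.abelian_group_axioms g]
      by (simp add: lincomb_def)
  qed
  let ?R' = "opposite_ring R"
  let ?C = "free_left_module ?R' m"
  have R': "ring ?R'" by (rule ring_opposite[OF ring])
  interpret C: left_module ?R' ?C by (rule left_module_free[OF R'])
  let ?B = "singleton_module ?C"
  interpret B: left_module ?R' ?B by (rule left_module_singleton[OF C.left_module_axioms])
  have B: "right_module R ?B"
    using B.left_module_axioms by (simp add: right_module_iff_opposite)
  let ?\<iota> = "\<lambda>x :: nat \<Rightarrow> 'r. {x}"
  note \<iota> = mod_epi_hom[OF singleton_mod_epi, of ?R' ?C]
  define col where "col j = (\<lambda>i\<in>{..<m}. a i j)" for j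
  have col: "col j \<in> carrier ?C" if "j < n" for j
    using PiE_lessThan_mem[of "a i" n "carrier R" j for i] a that by (simp add: col_def)
  have eC: "unit_vector ?R' m i \<in> carrier ?C" for i
    using unit_vector_closed[OF R', of m i] by simp
  have "(\<Sum>j<n. frag_of (?\<iota> (col j), v j))
      = (\<Sum>j<n. frag_of (\<Oplus>\<^bsub>?B\<^esub>i\<in>{..<m}. a i j \<odot>\<^bsub>?B\<^esub> ?\<iota> (unit_vector ?R' m i), v j))"
  proof (rule sum.cong[OF refl])
    fix j assume "j \<in> {..<n}"
    then have j: "j < n" by simp
    have "?\<iota> (col j) = lincomb ?B m (\<lambda>i. ?\<iota> (unit_vector ?R' m i)) (col j)"
      by (rule B.hom_from_free_eq_lincomb[OF \<iota> col[OF j]])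
    also have "\<dots> = (\<Oplus>\<^bsub>?B\<^esub>i\<in>{..<m}. a i j \<odot>\<^bsub>?B\<^esub> ?\<iota> (unit_vector ?R' m i))"
      unfolding lincomb_def
    proof (rule B.M.finsum_cong'[OF refl])
      show "(\<lambda>i. a i j \<odot>\<^bsub>?B\<^esub> ?\<iota> (unit_vector ?R' m i)) \<in> {..<m} \<rightarrow> carrier ?B"
        using a j mod_hom_closed[OF \<iota> eC] by (intro funcsetI B.smult_closed) (auto simp: PiE_lessThan_mem)
    qed (simp add: col_def)
    finally show "frag_of (?\<iota> (col j), v j)
        = frag_of (\<Oplus>\<^bsub>?B\<^esub>i\<in>{..<m}. a i j \<odot>\<^bsub>?B\<^esub> ?\<iota> (unit_vector ?R' m i), v j)" by simp
  qed
  also have "\<dots> \<in> tensor_rels R ?B V"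
  proof (rule tensor_rels_of_relations[OF B V])
    show "a i j \<in> carrier R" if "j < n" for i j
      using a[of i] that by (simp add: PiE_lessThan_mem)
    show "?\<iota> (unit_vector ?R' m i) \<in> carrier ?B" for i
      by (rule mod_hom_closed[OF \<iota> eC])
  qed (use v rel in simp_all)
  finally have zero: "(\<Sum>j<n. frag_of (?\<iota> (col j), v j)) \<in> tensor_rels R ?B V" .
  have "\<exists>(k :: nat) b w. (\<forall>l<k. b l \<in> {..<n} \<rightarrow>\<^sub>E carrier R \<and>
        lincomb ?B n (\<lambda>j. ?\<iota> (col j)) (b l) = \<zero>\<^bsub>?B\<^esub> \<and> w l \<in> carrier V) \<and>
      (\<forall>j<n. v j = (\<Oplus>\<^bsub>V\<^esub>l\<in>{..<k}. b l j \<odot>\<^bsub>V\<^esub> w l))"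
    using mod_hom_closed[OF \<iota> col] v
    by (intro flat_tensor_zero_imp_relations[OF flat V B _ _ zero]) auto
  then obtain k :: nat and b w where
    b: "\<And>l. l < k \<Longrightarrow> b l \<in> {..<n} \<rightarrow>\<^sub>E carrier R"
    and b_zero: "\<And>l. l < k \<Longrightarrow> lincomb ?B n (\<lambda>j. ?\<iota> (col j)) (b l) = \<zero>\<^bsub>?B\<^esub>"
    and w: "\<And>l. l < k \<Longrightarrow> w l \<in> carrier V"
    and vw: "\<And>j. j < n \<Longrightarrow> v j = (\<Oplus>\<^bsub>V\<^esub>l\<in>{..<k}. b l j \<odot>\<^bsub>V\<^esub> w l)"
    by blast
  interpret L: left_module R "regular_left_module R" by (rule left_module_regular[OF ring])
  interpret L': left_module ?R' "regular_left_module ?R'" by (rule left_module_regular[OF R'])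
  \<comment> \<open>The relation \<open>b l\<close> between the columns, read in \<open>R\<^sup>m\<close> instead of its copy and in coordinate \<open>i\<close>.\<close>
  have ab: "(\<Oplus>\<^bsub>regular_left_module R\<^esub>j\<in>{..<n}. a i j \<otimes>\<^bsub>R\<^esub> b l j) = \<zero>\<^bsub>R\<^esub>" if i: "i < m" and l: "l < k" for i l
  proof -
    have bl: "b l j \<in> carrier R" if "j < n" for j
      using b[OF l] that by (rule PiE_lessThan_mem)
    have cc: "b l j \<odot>\<^bsub>?C\<^esub> col j \<in> carrier ?C" if "j < n" for j
      using bl[OF that] col[OF that] by (intro C.smult_closed) simp_all
    have "?\<iota> (\<Oplus>\<^bsub>?C\<^esub>j\<in>{..<n}. b l j \<odot>\<^bsub>?C\<^esub> col j) = (\<Oplus>\<^bsub>?B\<^esub>j\<in>{..<n}. ?\<iota> (b l j \<odot>\<^bsub>?C\<^esub> col j))"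
      using cc by (intro mod_hom_finsum[OF C.M.abelian_group_axioms B.M.abelian_group_axioms \<iota>]) auto
    also have "\<dots> = lincomb ?B n (\<lambda>j. ?\<iota> (col j)) (b l)"
      unfolding lincomb_def
    proof (rule B.M.finsum_cong'[OF refl])
      show "?\<iota> (b l j \<odot>\<^bsub>?C\<^esub> col j) = b l j \<odot>\<^bsub>?B\<^esub> ?\<iota> (col j)" if "j \<in> {..<n}" for j
        using bl col that by (intro mod_hom_smult[OF \<iota>]) auto
      show "(\<lambda>j. b l j \<odot>\<^bsub>?B\<^esub> ?\<iota> (col j)) \<in> {..<n} \<rightarrow> carrier ?B"
        using bl mod_hom_closed[OF \<iota> col] by (intro funcsetI B.smult_closed) auto
    qed
    also have "\<dots> = {\<zero>\<^bsub>?C\<^esub>}"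
      using b_zero[OF l] by (simp add: singleton_module_def)
    finally have zero_C: "(\<Oplus>\<^bsub>?C\<^esub>j\<in>{..<n}. b l j \<odot>\<^bsub>?C\<^esub> col j) = \<zero>\<^bsub>?C\<^esub>" by simp
    have "\<zero>\<^bsub>R\<^esub> = (\<Oplus>\<^bsub>?C\<^esub>j\<in>{..<n}. b l j \<odot>\<^bsub>?C\<^esub> col j) i"
      unfolding zero_C using i by simp
    also have "\<dots> = (\<Oplus>\<^bsub>regular_left_module ?R'\<^esub>j\<in>{..<n}. (b l j \<odot>\<^bsub>?C\<^esub> col j) i)"
      using cc by (intro mod_hom_finsum[OF C.M.abelian_group_axioms L'.M.abelian_group_axioms
            mod_hom_coordinate[OF i]]) auto
    also have "\<dots> = (\<Oplus>\<^bsub>regular_left_module R\<^esub>j\<in>{..<n}. (b l j \<odot>\<^bsub>?C\<^esub> col j) i)"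
      by (simp only: finsum_regular_opposite)
    also have "\<dots> = (\<Oplus>\<^bsub>regular_left_module R\<^esub>j\<in>{..<n}. a i j \<otimes>\<^bsub>R\<^esub> b l j)"
      using i bl a[of i] by (intro L.M.finsum_cong') (auto simp: col_def PiE_lessThan_mem)
    finally show ?thesis by simp
  qed
  let ?Fk = "free_left_module R k"
  interpret Fk: left_module R ?Fk by (rule left_module_free[OF ring])
  define row where "row j = (\<lambda>l\<in>{..<k}. b l j)" for j
  have row: "row \<in> {..<n} \<rightarrow> carrier ?Fk"
  proof (rule funcsetI)
    fix j assume "j \<in> {..<n}"
    then have "b l j \<in> carrier R" if "l < k" for l
      using PiE_lessThan_mem[OF b[OF that]] by simp
    then show "row j \<in> carrier ?Fk" by (simp add: row_def)
  qed
  let ?\<alpha> = "lincomb ?Fk n row"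
  let ?\<beta> = "lincomb V k w"
  have \<alpha>: "?\<alpha> \<in> mod_hom R ?Fn ?Fk" by (rule Fk.lincomb_hom[OF row])
  have \<beta>: "?\<beta> \<in> mod_hom R ?Fk V" using w by (intro V.lincomb_hom) auto
  have \<alpha>a: "?\<alpha> (a i) = \<zero>\<^bsub>?Fk\<^esub>" if i: "i < m" for i
  proof (rule PiE_ext[of _ "{..<k}" "\<lambda>_. carrier R"])
    show "?\<alpha> (a i) \<in> {..<k} \<rightarrow>\<^sub>E carrier R"
      using mod_hom_closed[OF \<alpha> a] by simp
    show "\<zero>\<^bsub>?Fk\<^esub> \<in> {..<k} \<rightarrow>\<^sub>E carrier R"
      using Fk.M.zero_closed by simp
    fix l assume "l \<in> {..<k}"
    then have l: "l < k" by simp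
    have "?\<alpha> (a i) l = (\<Oplus>\<^bsub>regular_left_module R\<^esub>j\<in>{..<n}. (a i j \<odot>\<^bsub>?Fk\<^esub> row j) l)"
      unfolding lincomb_def using a[of i] row
      by (intro mod_hom_finsum[OF Fk.M.abelian_group_axioms L.M.abelian_group_axioms
            mod_hom_coordinate[OF l]] funcsetI Fk.smult_closed)
         (auto simp: PiE_lessThan_mem Pi_iff)
    also have "\<dots> = (\<Oplus>\<^bsub>regular_left_module R\<^esub>j\<in>{..<n}. a i j \<otimes>\<^bsub>R\<^esub> b l j)"
      using l b[OF l] a[of i] by (intro L.M.finsum_cong') (auto simp: row_def PiE_lessThan_mem)
    also have "\<dots> = \<zero>\<^bsub>?Fk\<^esub> l"
      using ab[OF i l] l by simp
    finally show "?\<alpha> (a i) l = \<zero>\<^bsub>?Fk\<^esub> l" .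
  qed
  have \<alpha>f: "?\<alpha> (f x) = \<zero>\<^bsub>?Fk\<^esub>" if x: "x \<in> carrier ?Fm" for x
  proof (rule Fk.hom_from_free_eqI[OF mod_hom_comp[OF f \<alpha>] _ _ x, of "\<lambda>_. \<zero>\<^bsub>?Fk\<^esub>"])
    show "(\<lambda>_. \<zero>\<^bsub>?Fk\<^esub>) \<in> mod_hom R ?Fm ?Fk"
    proof (rule mod_homI)
      show "\<zero>\<^bsub>?Fk\<^esub> = \<zero>\<^bsub>?Fk\<^esub> \<oplus>\<^bsub>?Fk\<^esub> \<zero>\<^bsub>?Fk\<^esub>" by (simp del: module_power_simps)
      show "\<zero>\<^bsub>?Fk\<^esub> = c \<odot>\<^bsub>?Fk\<^esub> \<zero>\<^bsub>?Fk\<^esub>" if "c \<in> carrier R" for c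
        using that by (simp del: module_power_simps)
    qed (rule Fk.M.zero_closed)
    show "?\<alpha> (f (unit_vector R m i)) = \<zero>\<^bsub>?Fk\<^esub>" if "i < m" for i
      using \<alpha>a[OF that] unfolding a_def .
  qed
  have "\<exists>q\<in>mod_hom R G ?Fk. \<forall>x\<in>carrier ?Fn. q (h x) = ?\<alpha> x"
  proof (rule mod_hom_factor_epi[OF Fn.left_module_axioms G Fk.M.abelian_group_axioms h \<alpha>])
    show "?\<alpha> x = \<zero>\<^bsub>?Fk\<^esub>" if "x \<in> carrier ?Fn" "h x = \<zero>\<^bsub>G\<^esub>" for x
      using ker[OF that(1)] that(2) \<alpha>f by blast
  qed
  then obtain q where q: "q \<in> mod_hom R G ?Fk" and qh: "\<And>x. x \<in> carrier ?Fn \<Longrightarrow> q (h x) = ?\<alpha> x"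
    by blast
  have \<beta>\<alpha>: "?\<beta> (?\<alpha> x) = g (h x)" if x: "x \<in> carrier ?Fn" for x
  proof (rule V.hom_from_free_eqI[OF mod_hom_comp[OF \<alpha> \<beta>] gh _ x])
    fix j assume j: "j < n"
    have "?\<beta> (?\<alpha> (unit_vector R n j)) = ?\<beta> (row j)"
      using Fk.lincomb_unit_vector[OF row j] by simp
    also have "\<dots> = (\<Oplus>\<^bsub>V\<^esub>l\<in>{..<k}. b l j \<odot>\<^bsub>V\<^esub> w l)"
      unfolding lincomb_def using b w j
      by (intro V.M.finsum_cong') (auto simp: row_def PiE_lessThan_mem)
    also have "\<dots> = g (h (unit_vector R n j))"
      using vw[OF j] by (simp add: v_def)
    finally show "?\<beta> (?\<alpha> (unit_vector R n j)) = g (h (unit_vector R n j))" .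
  qed
  have "g x = ?\<beta> (q x)" if "x \<in> carrier G" for x
    using mod_epi_surj[OF h that] \<beta>\<alpha> qh by force
  then show ?thesis using q \<beta> by blast
qed

section \<open>Quasi-flatness\<close>

text \<open>
  Flatness gives more than quasi-flatness: \<open>M\<close> may be any module, not only a power of \<open>V\<close>.
\<close>

corollary flat_imp_rel_flat:
  fixes R :: "('r, 'k) ring_scheme"
  assumes flat: "flat TYPE((nat \<Rightarrow> 'r) set) R V" and V: "left_module R V" and M: "left_module R M"
  shows "rel_flat TYPE('x) TYPE('g) R M V"
  unfolding rel_flat_def
proof (intro allI impI, elim conjE)
  fix M' :: "('r, 'x) module" and p u and G :: "('r, 'g) module" and g
  assume M': "left_module R M'" and p: "p \<in> mod_epi R M M'" and u: "u \<in> mod_hom R V M'"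
    and G: "left_module R G" and fp: "finitely_presented R G" and g: "g \<in> mod_hom R G V"
  obtain k \<alpha> \<beta> where \<alpha>: "\<alpha> \<in> mod_hom R G (free_left_module R k)"
    and \<beta>: "\<beta> \<in> mod_hom R (free_left_module R k) V" and g_eq: "\<And>x. x \<in> carrier G \<Longrightarrow> g x = \<beta> (\<alpha> x)"
    using flat_hom_from_finitely_presented_factors[OF flat V G fp g] by blast
  obtain h where h: "h \<in> mod_hom R (free_left_module R k) M"
    and ph: "\<And>x. x \<in> carrier (free_left_module R k) \<Longrightarrow> p (h x) = u (\<beta> x)"
    using hom_from_free_lift[OF M M' p mod_hom_comp[OF \<beta> u]] by blast
  show "\<exists>q\<in>mod_hom R G M. \<forall>x\<in>carrier G. p (q x) = u (g x)"
    using mod_hom_comp[OF \<alpha> h] ph[OF mod_hom_closed[OF \<alpha>]] g_eq by force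
qed

corollary rel_projective_imp_rel_flat_power:
  fixes R :: "('r, 'k) ring_scheme"
  assumes M: "left_module R M" and V: "left_module R V" and proj: "rel_projective R M V"
  shows "rel_flat TYPE('x) TYPE('g) R (module_power M n) V"
  unfolding rel_flat_def
proof (intro allI impI, elim conjE)
  fix M' :: "('r, 'x) module" and p u and G :: "('r, 'g) module" and g
  assume M': "left_module R M'" and p: "p \<in> mod_epi R (module_power M n) M'"
    and u: "u \<in> mod_hom R V M'" and g: "g \<in> mod_hom R G V"
  obtain h where h: "h \<in> mod_hom R V (module_power M n)"
    and ph: "\<And>x. x \<in> carrier V \<Longrightarrow> p (h x) = u x"
    using rel_projective_lift_power[OF M V M' proj p u] by blast
  show "\<exists>q\<in>mod_hom R G (module_power M n). \<forall>x\<in>carrier G. p (q x) = u (g x)"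
    using mod_hom_comp[OF g h] ph[OF mod_hom_closed[OF g]] by force
qed

theorem proposition1p1:
  fixes R :: "('r, 'k) ring_scheme"
    and V :: "('r, 'v, 'l) module_scheme"
  assumes "ring R"
    and "left_module R V"
  shows "(quasi_projective R V \<longrightarrow> quasi_flat TYPE('x) TYPE('g) R V) \<and>
    (flat TYPE((nat \<Rightarrow> 'r) set) R V \<longrightarrow> quasi_flat TYPE('x) TYPE('g) R V)"
proof (intro conjI impI)
  assume "quasi_projective R V"
  then show "quasi_flat TYPE('x) TYPE('g) R V"
    unfolding quasi_projective_def quasi_flat_def
    using rel_projective_imp_rel_flat_power[OF assms(2,2)] by blast
next
  assume "flat TYPE((nat \<Rightarrow> 'r) set) R V"
  then show "quasi_flat TYPE('x) TYPE('g) R V"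
    unfolding quasi_flat_def
    using flat_imp_rel_flat[OF _ assms(2) left_module_power[OF assms(2)]] by blast
qed

end
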